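(* Let $k$ be an integer with $k \geq 5$. Let $G$ be a finite abelian group (written additively) and let $A \subseteq G$ be a $k$-element $S_3$-set in $G$. Then \[ |G| \;\geq\; \frac{k(k-1)(k-2)}{2} - \frac{7k(k-1)}{2} - 2k - |G[2]|\,(k-2), \] where $G[2] = \{x \in G \setminus \{0\} : 2x = 0\}$.
   Context: For a positive integer $h$ and a subset $A$ of an additive abelian group $G$, the restricted $h$-fold sumset of $A$ is \[ h^\wedge A = \{a_1 + a_2 + \cdots + a_h : a_i \in A,\ a_i \neq a_j \text{ for } i \neq j\}. \] A subset $A = \{a_1,\dots,a_k\}$ of $G$ with $|A| = k$ is called an $S_h$-set of size $k$ if all sums of $h$ distinct elements of $A$ are distinct (that is, distinct $h$-element subsets of $A$ have distinct sums), equivalently $|h^\wedge A| = \binom{k}{h}$. In particular, $A$ is an $S_3$-set of size $k$ if $|3^\wedge A| = \binom{k}{3}$. Note that $G[2]$ here excludes the zero element, so it is the set of elements of $G$ of order exactly $2$. The inequality is between integers/real numbers (the right-hand side may be negative). *)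

theory Defs
  imports Complex_Main
begin

definition restricted_sumset :: "nat \<Rightarrow> 'a::ab_group_add set \<Rightarrow> 'a set" where
  "restricted_sumset h A =
     {\<Sum>i<h. a i |a. (\<forall>i<h. a i \<in> A) \<and> inj_on a {..<h}}"

definition S_set :: "nat \<Rightarrow> 'a::ab_group_add set \<Rightarrow> bool" where
  "S_set h A \<longleftrightarrow> finite A \<and>
     (\<forall>B C. B \<subseteq> A \<longrightarrow> C \<subseteq> A \<longrightarrow> card B = h \<longrightarrow> card C = h \<longrightarrow> \<Sum>B = \<Sum>C \<longrightarrow> B = C)"

definition two_torsion :: "'a::ab_group_add set" where
  \<comment> \<open>zero is excluded: these are the elements of order exactly 2\<close>
  "two_torsion = {x. x \<noteq> 0 \<and> x + x = 0}"

lemma restricted_sumset_eq_image: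
  fixes A :: "'a::ab_group_add set"
  assumes "finite A"
  shows "restricted_sumset h A = (\<lambda>B. \<Sum>B) ` {B. B \<subseteq> A \<and> card B = h}"
proof (intro equalityI subsetI)
  fix x assume "x \<in> restricted_sumset h A"
  then obtain a where a: "x = (\<Sum>i<h. a i)" "\<forall>i<h. a i \<in> A" "inj_on a {..<h}"
    unfolding restricted_sumset_def by blast
  have "x = \<Sum>(a ` {..<h})" using a by (simp add: sum.reindex)
  moreover have "a ` {..<h} \<subseteq> A" "card (a ` {..<h}) = h"
    using a by (auto simp: card_image)
  ultimately show "x \<in> (\<lambda>B. \<Sum>B) ` {B. B \<subseteq> A \<and> card B = h}" by blast
next
  fix x assume "x \<in> (\<lambda>B. \<Sum>B) ` {B. B \<subseteq> A \<and> card B = h}"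
  then obtain B where B: "x = \<Sum>B" "B \<subseteq> A" "card B = h" by blast
  have "finite B" using B assms finite_subset by blast
  then obtain a where a: "bij_betw a {..<h} B"
    using B ex_bij_betw_nat_finite[of B] by (auto simp: atLeast0LessThan)
  have "x = (\<Sum>i<h. a i)" using B sum.reindex_bij_betw[OF a, of "\<lambda>y. y"] by simp
  moreover have "\<forall>i<h. a i \<in> A" using a B by (auto simp: bij_betw_def)
  ultimately show "x \<in> restricted_sumset h A"
    using a unfolding restricted_sumset_def bij_betw_def by blast
qed

lemma S_set_iff_card:
  fixes A :: "'a::ab_group_add set"
  assumes "finite A"
  shows "S_set h A \<longleftrightarrow> card (restricted_sumset h A) = card A choose h"
proof -
  let ?S = "{B. B \<subseteq> A \<and> card B = h}"
  have fin: "finite ?S" using assms by simp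
  have "S_set h A \<longleftrightarrow> inj_on (\<lambda>B. \<Sum>B) ?S"
    unfolding S_set_def inj_on_def using assms by blast
  also have "\<dots> \<longleftrightarrow> card ((\<lambda>B. \<Sum>B) ` ?S) = card ?S"
    using fin by (simp add: inj_on_iff_eq_card)
  finally show ?thesis
    using assms by (simp add: restricted_sumset_eq_image n_subsets)
qed

end

theory Submission
  imports Defs
begin

text \<open>
  Count the values \<open>x = a + b - c\<close> with \<open>a, b, c \<in> A\<close> distinct.  There are
  \<open>k(k - 1)(k - 2)/2\<close> such expressions up to exchanging \<open>a\<close> and \<open>b\<close>, and all the values lie in
  the group, so its order is at least that number minus the number of colliding pairs.  Since \<open>A\<close>
  also has distinct sums of two elements (as \<open>k \<ge> 5\<close>), the element \<open>c\<close> determines the expression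
  of a given value.  If \<open>a + b - c = d + e - f\<close> with \<open>c \<noteq> f\<close>, then \<open>a + b + f = d + e + c\<close>, and
  unless one of the two sides repeats an element, this contradicts the S_3 property.  So, up to
  symmetry, \<open>f = a\<close>, and three kinds of collision remain (\<open>collisions_cover\<close>).

  (1) \<open>2a + b = c + d + e\<close> with \<open>c, d, e\<close> distinct.  The pair \<open>(a, b)\<close> determines the set
  \<open>{c, d, e}\<close>, which leaves three choices of \<open>c\<close>, so there are at most \<open>3k(k - 1)\<close> collisions.
  If \<open>a\<close> is the midpoint of a progression in \<open>A\<close> and \<open>b\<close> lies off it, one of the three choices
  is lost: this saves \<open>k - 3\<close> for each midpoint (\<open>card_one_sided\<close>).

  (2) \<open>2a = 2c\<close>, with \<open>b\<close> arbitrary.  Here \<open>a - c\<close> has order two, and every element of order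
  two is a difference of at most one unordered pair of \<open>A\<close>.  With \<open>d\<close> the number of elements of
  order two that are differences of \<open>A\<close>, this gives \<open>d(k - 2)\<close> collisions.

  (3) \<open>2a + b = 2c + e\<close> with four distinct elements.  Put \<open>t = 2a - 2c = e - b\<close>.  For most
  \<open>{a, c}\<close> at most one \<open>b\<close> is possible, which accounts for \<open>k(k - 1)/2 - d\<close> collisions.
  More than one \<open>b\<close> requires \<open>t\<close> to have order two or to be the step of a three-term progression
  in \<open>A\<close>.  The number of pairs with the same exceptional \<open>t\<close> is bounded as follows: if \<open>(a, c)\<close>
  and \<open>(a', c')\<close> both double to \<open>t\<close>, then \<open>a - c - a' + c'\<close> is killed by 2, and by the S_3
  property it is, apart from degenerate configurations, not a difference of \<open>A\<close>.  So many pairs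
  force many elements of order two that are not differences of \<open>A\<close>.  If \<open>z\<close> is the number of
  these, then \<open>t\<close> comes from at most \<open>1 + z\<close> unordered pairs when it has order two, from at most
  \<open>z\<close> ordered pairs when it has order three, and from at most \<open>z + k - 4\<close> ordered pairs for the
  remaining progressions (\<open>doubled_order_two\<close>, \<open>doubled_order_three\<close>, \<open>doubled_progression\<close>).

  Writing \<open>d + z\<close> for the number of elements of order two, the kinds (1) and (2) and the main part
  of (3) use \<open>7k(k - 1)/2 + d(k - 2)\<close> collisions and leave savings of \<open>d\<close> and of \<open>k - 3\<close> per
  midpoint.  The allowance \<open>2k + z(k - 2)\<close> and these savings pay for the exceptional part of (3),
  because \<open>d\<close> is itself small compared to \<open>z\<close> (\<open>realised_bound\<close>, \<open>excess_arithmetic\<close>).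
\<close>

section \<open>Counting tools\<close>

lemma card_le_fibre_bound:
  assumes "finite S" and "\<And>y. y \<in> f ` S \<Longrightarrow> card {x \<in> S. f x = y} \<le> n"
  shows "card S \<le> n * card (f ` S)"
proof -
  have "card S = card (\<Union>y\<in>f ` S. {x \<in> S. f x = y})"
    by (rule arg_cong[where f = card]) auto
  also have "\<dots> \<le> (\<Sum>y\<in>f ` S. card {x \<in> S. f x = y})"
    using assms(1) by (intro card_UN_le) simp
  also have "\<dots> \<le> (\<Sum>y\<in>f ` S. n)"
    by (intro sum_mono assms(2))
  finally show ?thesis by (simp add: mult.commute)
qed

text \<open>
  A fibre with \<open>m \<ge> 1\<close> points loses \<open>m - 1\<close> in the image and has \<open>m(m - 1)\<close> ordered
  collisions, and \<open>2(m - 1) \<le> m(m - 1)\<close>.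
\<close>

lemma two_card_le_image_plus_collisions:
  fixes S :: "('b \<times> 'c) set"
  assumes "finite S"
  shows "2 * card S \<le> 2 * card (fst ` S) + card {(x, c, c'). (x, c) \<in> S \<and> (x, c') \<in> S \<and> c \<noteq> c'}"
proof -
  define R where "R x = {c. (x, c) \<in> S}" for x
  have dom: "x \<in> fst ` S \<longleftrightarrow> (\<exists>c. (x, c) \<in> S)" for x
    by force
  have finR: "finite (R x)" for x
    by (rule finite_subset[of _ "snd ` S"]) (use assms in \<open>force simp: R_def\<close>)+
  have S: "card S = (\<Sum>x\<in>fst ` S. card (R x))"
  proof -
    have "S = Sigma (fst ` S) R" by (auto simp: R_def dom)
    thus ?thesis using card_SigmaI[of "fst ` S" R] assms finR by auto
  qed
  have "card {(x, c, c'). (x, c) \<in> S \<and> (x, c') \<in> S \<and> c \<noteq> c'}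
      = card (Sigma (fst ` S) (\<lambda>x. Sigma (R x) (\<lambda>c. R x - {c})))"
    by (rule arg_cong[where f = card]) (auto simp: R_def dom)
  also have "\<dots> = (\<Sum>x\<in>fst ` S. card (R x) * (card (R x) - 1))"
    using assms finR by (simp add: card_SigmaI)
  finally have O: "card {(x, c, c'). (x, c) \<in> S \<and> (x, c') \<in> S \<and> c \<noteq> c'}
      = (\<Sum>x\<in>fst ` S. card (R x) * (card (R x) - 1))" .
  have "2 * m \<le> 2 + m * (m - 1)" for m :: nat
  proof (cases "m \<le> 2")
    case True
    then have "m = 0 \<or> m = 1 \<or> m = 2" by auto
    thus ?thesis by auto
  next
    case False
    then have "m * 2 \<le> m * (m - 1)" by (intro mult_le_mono) auto
    thus ?thesis by linarith
  qed
  then have "(\<Sum>x\<in>fst ` S. 2 * card (R x)) \<le> (\<Sum>x\<in>fst ` S. 2 + card (R x) * (card (R x) - 1))"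
    by (intro sum_mono)
  thus ?thesis unfolding S O by (simp only: sum.distrib sum_distrib_left sum_constant mult.commute[of "card _" 2] of_nat_id)
qed

lemma card_UN_le_mult:
  assumes "finite I" "\<And>i. i \<in> I \<Longrightarrow> card (F i) \<le> n"
  shows "card (\<Union>i\<in>I. F i) \<le> card I * n"
proof -
  have "card (\<Union>i\<in>I. F i) \<le> (\<Sum>i\<in>I. card (F i))" by (rule card_UN_le[OF assms(1)])
  also have "\<dots> \<le> of_nat (card I) * n" by (rule sum_bounded_above) (rule assms(2))
  finally show ?thesis by simp
qed

lemma card_off_diagonal:
  assumes "finite C"
  shows "card {(a, c). a \<in> C \<and> c \<in> C \<and> a \<noteq> c} = card C * (card C - 1)"
proof -
  have "{(a, c). a \<in> C \<and> c \<in> C \<and> a \<noteq> c} = Sigma C (\<lambda>a. C - {a})" by auto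
  thus ?thesis using assms by (simp add: card_SigmaI)
qed

section \<open>Additive rigidity of S_3-sets\<close>

locale S3_set =
  fixes A :: "'a::{ab_group_add,finite} set"
  assumes card_ge_5: "5 \<le> card A"
    and S3: "S_set 3 A"
begin

lemma triple_sum_unique:
  assumes "x + y + z = u + v + w"
    and "x \<in> A" "y \<in> A" "z \<in> A" "x \<noteq> y" "x \<noteq> z" "y \<noteq> z"
    and "u \<in> A" "v \<in> A" "w \<in> A" "u \<noteq> v" "u \<noteq> w" "v \<noteq> w"
  shows "{x, y, z} = {u, v, w}"
proof -
  have "\<Sum>{x, y, z} = \<Sum>{u, v, w}" using assms by (simp add: add.assoc)
  moreover have "card {x, y, z} = 3" "card {u, v, w} = 3" using assms by auto
  moreover have "{x, y, z} \<subseteq> A" "{u, v, w} \<subseteq> A" using assms by auto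
  ultimately show ?thesis using S3 unfolding S_set_def by metis
qed

text \<open>
  An S_3-set with at least five elements is an S_2-set: add to both sides an element of \<open>A\<close> that is
  different from the four summands.
\<close>

lemma pair_sum_unique:
  assumes eq: "a + b = c + d"
    and mem: "a \<in> A" "b \<in> A" "c \<in> A" "d \<in> A" and ne: "a \<noteq> b" "c \<noteq> d"
  shows "a = c \<and> b = d \<or> a = d \<and> b = c"
proof -
  have "card {a, b, c, d} \<le> 4" by (simp add: card_insert_if)
  then have "\<not> A \<subseteq> {a, b, c, d}"
    using card_mono[of "{a, b, c, d}" A] card_ge_5 by auto
  then obtain g where g: "g \<in> A" "g \<notin> {a, b, c, d}" by auto
  have "{a, b, g} = {c, d, g}"
    by (rule triple_sum_unique) (use assms g in auto)
  moreover have "{a, b, g} - {g} = {a, b}" "{c, d, g} - {g} = {c, d}" using g by auto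
  ultimately have "{a, b} = {c, d}" by metis
  thus ?thesis by (simp only: doubleton_eq_iff)
qed

text \<open>
  Two representations of the same difference as \<open>(b + t) - b\<close> and \<open>(b' + t) - b'\<close> give
  \<open>b + (b' + t) = b' + (b + t)\<close>, which has to be degenerate.  Consequently the representations of
  \<open>t\<close> are consecutive terms of a progression.
\<close>

lemma equal_differences_adjacent:
  assumes "b \<in> A" "b + t \<in> A" "b' \<in> A" "b' + t \<in> A" "t \<noteq> 0"
  shows "b' = b \<or> b' = b + t \<or> b = b' + t"
proof -
  have "b + (b' + t) = b' + (b + t)" by (simp add: algebra_simps)
  from pair_sum_unique[OF this] assms show ?thesis by auto
qed

section \<open>Elements of order two that are not differences\<close>

definition unrealised :: "'a set" where
  "unrealised = {s \<in> two_torsion. \<forall>u\<in>A. \<forall>v\<in>A. s \<noteq> u - v}"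

text \<open>
  If \<open>s = p + u - q - v\<close> has order two and is a difference \<open>x - y\<close>, then also \<open>s = y - x\<close>, and
  this gives two equations between sums of three elements, \<open>p + u + y = q + v + x\<close> and the one with
  \<open>x\<close> and \<open>y\<close> exchanged.  Both must be degenerate, which forces \<open>{x, y}\<close> to be \<open>{q, v}\<close> or
  \<open>{p, u}\<close>.
\<close>

lemma balanced_quadruple:
  assumes mem: "p \<in> A" "u \<in> A" "q \<in> A" "v \<in> A"
    and ne: "p \<noteq> u" "p \<noteq> q" "p \<noteq> v" "u \<noteq> q" "u \<noteq> v" "q \<noteq> v"
    and tor: "p + u + (p + u) = q + v + (q + v)"
  shows "p + u - q - v \<in> unrealised \<or> p + u = q + q \<and> p + u = v + v \<or> q + v = p + p \<and> q + v = u + u"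
proof (rule ccontr)
  assume neg: "\<not> ?thesis"
  define s where "s = p + u - q - v"
  have s2: "s + s = 0" using tor by (simp add: s_def algebra_simps)
  have s0: "s \<noteq> 0"
  proof
    assume "s = 0"
    then have "p + u = q + v" by (simp add: s_def algebra_simps)
    from pair_sum_unique[OF this] mem ne show False by auto
  qed
  have "s \<in> two_torsion" using s2 s0 by (simp add: two_torsion_def)
  with neg obtain x y where xy: "x \<in> A" "y \<in> A" "s = x - y"
    by (auto simp: unrealised_def s_def)
  have xney: "x \<noteq> y" using xy s0 by auto
  have sm: "s = y - x" using s2 xy by (metis add_eq_0_iff minus_diff_eq)
  have e1: "p + u + y = q + v + x" using xy(3) by (simp add: s_def algebra_simps)
  have e2: "p + u + x = q + v + y" using sm by (simp add: s_def algebra_simps)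
  have i1: "x \<in> {q, v} \<or> y \<in> {p, u}"
    using triple_sum_unique[OF e1] mem ne xy xney by auto
  have i2: "y \<in> {q, v} \<or> x \<in> {p, u}"
    using triple_sum_unique[OF e2] mem ne xy xney by auto
  consider "x = q" "y = v" | "x = v" "y = q" | "x = p" "y = u" | "x = u" "y = p"
    using i1 i2 ne xney by auto
  then show False
  proof cases
    case 1
    then have "p + u = q + q" "p + u = v + v" using e1 e2 by (auto simp: algebra_simps)
    with neg show ?thesis by blast
  next
    case 2
    then have "p + u = q + q" "p + u = v + v" using e1 e2 by (auto simp: algebra_simps)
    with neg show ?thesis by blast
  next
    case 3
    then have "q + v = p + p" "q + v = u + u" using e1 e2 by (auto simp: algebra_simps)
    with neg show ?thesis by blast
  next
    case 4
    then have "q + v = p + p" "q + v = u + u" using e1 e2 by (auto simp: algebra_simps)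
    with neg show ?thesis by blast
  qed
qed

text \<open>
  The degenerate alternatives of \<open>balanced_quadruple\<close> would identify \<open>p\<close> with \<open>u\<close> or \<open>q\<close> with \<open>v\<close>.
\<close>

lemma disjoint_torsion_pairs:
  assumes "p \<in> A" "q \<in> A" "u \<in> A" "v \<in> A"
    and "p \<noteq> q" "p \<noteq> u" "p \<noteq> v" "q \<noteq> u" "q \<noteq> v" "u \<noteq> v"
    and "p + p = q + q" "u + u = v + v"
  shows "p - q + (u - v) \<in> unrealised"
proof -
  have "p + u + (p + u) = (p + p) + (u + u)" by (simp add: algebra_simps)
  also have "\<dots> = q + v + (q + v)" using assms by (simp add: algebra_simps)
  finally have tor: "p + u + (p + u) = q + v + (q + v)" .
  have "p + u - q - v = p - q + (u - v)" by (simp add: algebra_simps)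
  with balanced_quadruple[of p u q v] tor assms show ?thesis
    by (metis add_left_cancel)
qed

section \<open>Pairs with a prescribed doubled difference\<close>

definition ends :: "'a \<Rightarrow> 'a set" where
  "ends t = {v \<in> A. v + t \<in> A \<or> v - t \<in> A}"

text \<open>
  Removing \<open>ends t\<close> is what makes these pairs rigid: by \<open>ends_free_difference\<close> their entries
  never differ by \<open>t\<close> itself.  Nothing is lost, since in the relation \<open>2a + b = 2c + e\<close>, with
  several possible \<open>b\<close> for \<open>t = 2a - 2c\<close>, the elements \<open>a\<close> and \<open>c\<close> turn out to avoid \<open>ends t\<close>.
\<close>

definition doubled :: "'a \<Rightarrow> ('a \<times> 'a) set" where
  "doubled t = {(a, c). a \<in> A - ends t \<and> c \<in> A - ends t \<and> a + a - (c + c) = t}"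

lemma ends_free_difference:
  assumes "a \<in> A - ends t" "c \<in> A"
  shows "a - c \<noteq> t"
  using assms by (auto simp: ends_def)

text \<open>
  Equal differences \<open>a - c = a' - c'\<close> of different pairs overlap as \<open>a = c'\<close> or \<open>c = a'\<close>.  Then
  three elements form a progression whose outer terms differ by twice the step, that is by \<open>t\<close>,
  which cannot happen off \<open>ends t\<close>.
\<close>

lemma doubled_inj:
  assumes t: "t \<noteq> 0"
  shows "inj_on (\<lambda>(a, c). a - c + s) (doubled t)"
proof -
  have "a = a' \<and> c = c'" if m: "(a, c) \<in> doubled t" "(a', c') \<in> doubled t" and eq: "a - c = a' - c'"
    for a c a' c'
  proof (rule ccontr)
    assume n: "\<not> ?thesis"
    have e: "a + c' = c + a'" using eq by (simp add: algebra_simps)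
    have t1: "a + a - (c + c) = t" and t2: "a' + a' - (c' + c') = t"
      using m by (auto simp: doubled_def)
    have "a \<noteq> a'" using n eq by auto
    have "a \<noteq> c" using t1 t by auto
    have "a \<noteq> c'"
    proof
      assume "a = c'"
      then have "a' - c = t" using e t1 by (simp add: algebra_simps)
      thus False using ends_free_difference[of a' t c] m by (auto simp: doubled_def)
    qed
    moreover have "c \<noteq> a'"
    proof
      assume "c = a'"
      then have "a - c' = t" using e t2 by (simp add: algebra_simps)
      thus False using ends_free_difference[of a t c'] m by (auto simp: doubled_def)
    qed
    ultimately show False using pair_sum_unique[OF e] \<open>a \<noteq> a'\<close> \<open>a \<noteq> c\<close> m by (auto simp: doubled_def)
  qed
  thus ?thesis unfolding inj_on_def by (auto simp only: split_paired_all split_conv add_right_cancel)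
qed

text \<open>
  The degenerate alternatives of \<open>balanced_quadruple\<close> would give \<open>a - c0 = t\<close> or \<open>a0 - c = t\<close>.
\<close>

lemma doubled_disjoint_unrealised:
  assumes m: "(a, c) \<in> doubled t" "(a0, c0) \<in> doubled t"
    and ne: "a \<noteq> c" "a \<noteq> a0" "a \<noteq> c0" "c \<noteq> a0" "c \<noteq> c0" "a0 \<noteq> c0"
  shows "a - c + (c0 - a0) \<in> unrealised"
proof -
  have mem: "a \<in> A - ends t" "c \<in> A - ends t" "a0 \<in> A - ends t" "c0 \<in> A - ends t"
    and t: "a + a - (c + c) = t" "a0 + a0 - (c0 + c0) = t"
    using m by (auto simp: doubled_def)
  have "a + c0 + (a + c0) - (c + a0 + (c + a0)) = (a + a - (c + c)) - (a0 + a0 - (c0 + c0))"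
    by (simp add: algebra_simps)
  then have tor: "a + c0 + (a + c0) = c + a0 + (c + a0)" using t by simp
  have "a + c0 - c - a0 = a - c + (c0 - a0)" by (simp add: algebra_simps)
  moreover have False if "a + c0 = a0 + a0"
  proof -
    have "a - c0 = t" using that t by (metis add_diff_cancel_right diff_diff_add)
    thus False using ends_free_difference mem by auto
  qed
  moreover have False if "c + a0 = c0 + c0"
  proof -
    have "a0 - c = (a0 + a0) - (c + a0)" by (simp add: algebra_simps)
    then have "a0 - c = t" using that t by simp
    thus False using ends_free_difference mem by auto
  qed
  ultimately show ?thesis using balanced_quadruple[of a c0 c a0] tor mem ne by (metis DiffD1)
qed

text \<open>
  Compare every pair \<open>(a, c)\<close> with a fixed pair \<open>(a0, c0)\<close>.  The value
  \<open>s = a - c - (a0 - c0)\<close> is killed by 2, and reversing \<open>(a, c)\<close> replaces it by \<open>s + t\<close>.  If the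
  pairs are disjoint, \<open>s\<close> is not a difference of \<open>A\<close> by \<open>doubled_disjoint_unrealised\<close>.  If they
  share an entry, one of \<open>s\<close> and \<open>s + t\<close> is, up to sign, the sum of \<open>t\<close> and a difference of order
  two of the unshared entries, and \<open>disjoint_torsion_pairs\<close> applies.
\<close>

lemma doubled_order_two:
  assumes t: "t \<noteq> 0" "t + t = 0" and uv: "u \<in> A" "v \<in> A" "u - v = t"
  shows "card (doubled t) \<le> 2 * (1 + card unrealised)"
proof (cases "doubled t = {}")
  case False
  then obtain a0 c0 where base: "(a0, c0) \<in> doubled t" by auto
  define R where "R = doubled t - {(a0, c0), (c0, a0)}"
  define \<phi> where "\<phi> = (\<lambda>s (a, c). a - c + s :: 'a)"
  have u: "u = v + t" using uv(3) by (simp add: algebra_simps)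
  have ends: "u \<in> ends t" "v \<in> ends t" using uv u by (auto simp: ends_def)
  have dich: "\<phi> (c0 - a0) p \<in> unrealised \<or> \<phi> (c0 - a0 + t) p \<in> unrealised" if "p \<in> R" for p
  proof -
    obtain a c where p: "p = (a, c)" by (cases p)
    have m: "(a, c) \<in> doubled t" and nb: "(a, c) \<noteq> (a0, c0)" "(a, c) \<noteq> (c0, a0)"
      using that by (auto simp: R_def p)
    have mem: "a \<in> A - ends t" "c \<in> A - ends t" "a0 \<in> A - ends t" "c0 \<in> A - ends t"
      and z1: "a + a - (c + c) - t = 0" and z2: "a0 + a0 - (c0 + c0) - t = 0"
      using m base by (auto simp: doubled_def)
    have ne: "a \<noteq> c" "a0 \<noteq> c0" "u \<noteq> v" using z1 z2 t u by auto
    have D: "x - y + (u - v) \<in> unrealised"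
      if "x \<in> A - ends t" "y \<in> A - ends t" "x \<noteq> y" "x + x = y + y" for x y
      by (rule disjoint_torsion_pairs) (use that ends uv ne t in \<open>auto simp: u algebra_simps\<close>)
    consider "a = a0" | "c = c0" | "a = c0" | "c = a0" | "a \<noteq> a0" "a \<noteq> c0" "c \<noteq> a0" "c \<noteq> c0"
      by blast
    then show ?thesis
    proof cases
      case 1
      have "c0 + c0 = c + c + ((a + a - (c + c) - t) - (a0 + a0 - (c0 + c0) - t))"
        by (simp add: 1)
      then have "c0 - c + (u - v) \<in> unrealised" using D[of c0 c] mem nb 1 z1 z2 by auto
      moreover have "c0 - c + (u - v) = a - c + (c0 - a0 + t)" using 1 u by simp
      ultimately show ?thesis by (simp add: \<phi>_def p)
    next
      case 2
      have "a + a = a0 + a0 + ((a + a - (c + c) - t) - (a0 + a0 - (c0 + c0) - t))"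
        by (simp add: 2)
      then have "a - a0 + (u - v) \<in> unrealised" using D[of a a0] mem nb 2 z1 z2 by auto
      moreover have "a - a0 + (u - v) = a - c + (c0 - a0 + t)" using 2 u by simp
      ultimately show ?thesis by (simp add: \<phi>_def p)
    next
      case 3
      have "a0 + a0 = c + c + ((a + a - (c + c) - t) + (a0 + a0 - (c0 + c0) - t)) + (t + t)"
        by (simp add: 3 algebra_simps)
      then have "a0 + a0 = c + c" by (simp only: z1 z2 t(2) add_0_right)
      moreover have "a0 \<noteq> c" using nb 3 by auto
      ultimately have "a0 - c + (u - v) \<in> unrealised" using D[of a0 c] mem by blast
      moreover have "a - c + (c0 - a0) = a0 - c + (u - v) - (a0 + a0 - (c0 + c0) - t) - (t + t)"
        using 3 u by (simp add: algebra_simps)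
      ultimately show ?thesis by (simp only: \<phi>_def p z2 t(2) diff_zero split_conv simp_thms)
    next
      case 4
      have "a + a = c0 + c0 + ((a + a - (c + c) - t) + (a0 + a0 - (c0 + c0) - t)) + (t + t)"
        by (simp add: 4 algebra_simps)
      then have "a + a = c0 + c0" by (simp only: z1 z2 t(2) add_0_right)
      moreover have "a \<noteq> c0" using nb 4 by auto
      ultimately have "a - c0 + (u - v) \<in> unrealised" using D[of a c0] mem by blast
      moreover have "a - c + (c0 - a0) = a - c0 + (u - v) - (a0 + a0 - (c0 + c0) - t) - (t + t)"
        using 4 u by (simp add: algebra_simps)
      ultimately show ?thesis by (simp only: \<phi>_def p z2 t(2) diff_zero split_conv simp_thms)
    next
      case 5
      then show ?thesis using doubled_disjoint_unrealised[OF m base] ne by (auto simp: \<phi>_def p)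
    qed
  qed
  have bound: "card {p \<in> R. \<phi> s p \<in> unrealised} \<le> card unrealised" for s
  proof (rule card_inj_on_le)
    show "inj_on (\<phi> s) {p \<in> R. \<phi> s p \<in> unrealised}"
      unfolding \<phi>_def by (rule inj_on_subset[OF doubled_inj[OF t(1)]]) (auto simp: R_def)
  qed auto
  have "doubled t \<subseteq> {(a0, c0), (c0, a0)} \<union> {p \<in> R. \<phi> (c0 - a0) p \<in> unrealised}
      \<union> {p \<in> R. \<phi> (c0 - a0 + t) p \<in> unrealised}"
    using dich by (auto simp: R_def)
  then have "card (doubled t) \<le> card ({(a0, c0), (c0, a0)} \<union> {p \<in> R. \<phi> (c0 - a0) p \<in> unrealised}
      \<union> {p \<in> R. \<phi> (c0 - a0 + t) p \<in> unrealised})"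
    by (intro card_mono) auto
  also have "\<dots> \<le> card {(a0, c0), (c0, a0)} + card {p \<in> R. \<phi> (c0 - a0) p \<in> unrealised}
      + card {p \<in> R. \<phi> (c0 - a0 + t) p \<in> unrealised}"
    by (rule order_trans[OF card_Un_le]) (rule add_right_mono, rule card_Un_le)
  also have "\<dots> \<le> 2 + card unrealised + card unrealised"
    by (intro add_mono bound) (rule card_insert_le_m1, simp_all)
  finally show ?thesis by simp
qed simp

definition progression :: "'a \<Rightarrow> 'a \<Rightarrow> bool" where
  "progression e t \<longleftrightarrow> e - t \<in> A \<and> e \<in> A \<and> e + t \<in> A"

lemma ends_progression:
  assumes pr: "progression e t" and t: "t + t \<noteq> 0"
  shows "ends t = {e - t, e, e + t}"
proof -
  have t0: "t \<noteq> 0" using t by auto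
  have start: "w \<in> {e - t, e} \<or> w = e + t \<and> w + t = e - t" if w: "w \<in> A" "w + t \<in> A" for w
  proof -
    have "w = e - t \<or> w = e \<or> e - t = w + t"
      using equal_differences_adjacent[of "e - t" t w] pr w t0 by (simp add: progression_def)
    moreover have "w = e \<or> w = e + t \<or> w = e - t"
      using equal_differences_adjacent[of e t w] pr w t0 by (auto simp: progression_def)
    ultimately show ?thesis by auto
  qed
  show ?thesis
  proof (intro equalityI subsetI)
    fix v assume "v \<in> ends t"
    then consider "v \<in> A" "v + t \<in> A" | "v - t \<in> A" "v - t + t \<in> A" by (auto simp: ends_def)
    then show "v \<in> {e - t, e, e + t}"
      using start[of v] start[of "v - t"] by cases (auto simp: algebra_simps)
  qed (use pr in \<open>auto simp: progression_def ends_def\<close>)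
qed

lemma progression_distinct:
  fixes e t :: 'a
  assumes "t + t \<noteq> 0"
  shows "e - t \<noteq> e" "e \<noteq> e + t" "e - t \<noteq> e + t"
proof -
  have "t \<noteq> 0" using assms by auto
  thus "e - t \<noteq> e" "e \<noteq> e + t" by auto
  have "t + t = (e + t) - (e - t)" by simp
  thus "e - t \<noteq> e + t" using assms by (metis right_minus_eq)
qed

text \<open>
  The value \<open>s = a - c + t\<close> is killed by 2.  If it were a difference \<open>x - y\<close>, then for
  each of the three ways of writing \<open>t = h - l\<close> inside the coset \<open>{e - t, e, e + t}\<close> the equation
  \<open>a + h + y = c + l + x\<close> would have to be degenerate.  If \<open>x \<noteq> c\<close> and \<open>y \<noteq> a\<close>, this means \<open>x = l\<close> or
  \<open>y = h\<close>, which can hold for only two of the three ways.  So \<open>x = c\<close> or \<open>y = a\<close>; exchanging \<open>x\<close> and \<open>y\<close>, which is possible because \<open>s = - s\<close>,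
  gives a contradiction.
\<close>

lemma doubled_order_three:
  assumes pr: "progression e t" and t: "t \<noteq> 0" "t + t + t = 0"
  shows "card (doubled t) \<le> card unrealised"
proof -
  have t2: "t + t \<noteq> 0" using t by auto
  note dist = progression_distinct[OF t2, of e]
  note ends = ends_progression[OF pr t2]
  have "(\<lambda>(a, c). a - c + t) ` doubled t \<subseteq> unrealised"
  proof clarify
    fix a c assume m: "(a, c) \<in> doubled t"
    then have mem: "a \<in> A - ends t" "c \<in> A - ends t" and z: "a + a - (c + c) - t = 0"
      by (auto simp: doubled_def)
    have ac: "a \<noteq> c" using z t by auto
    define s where "s = a - c + t"
    have "s + s = (a + a - (c + c) - t) + (t + t + t)" by (simp add: s_def algebra_simps)
    then have s2: "s + s = 0" using z t by simp
    have s0: "s \<noteq> 0"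
    proof
      assume "s = 0"
      then have "c - a = t" by (simp add: s_def algebra_simps)
      thus False using ends_free_difference mem by auto
    qed
    have "s \<noteq> x - y" if xy: "x \<in> A" "y \<in> A" for x y
    proof
      assume s: "s = x - y"
      have xney: "x \<noteq> y" using s s0 by auto
      have rot: "x \<in> {c, l} \<or> y \<in> {a, h}"
        if "s = x - y" "h - l = t" "h \<in> ends t" "l \<in> ends t" "x \<in> A" "y \<in> A" "x \<noteq> y" for x y h l
      proof -
        have h: "h = l + t" using that(2) by (simp add: algebra_simps)
        have "a + h + y = c + l + x" using that(1) by (simp add: s_def h algebra_simps)
        moreover have "h \<noteq> l" "h \<in> A" "l \<in> A" using that h t by (auto simp: ends_def)
        ultimately show ?thesis using triple_sum_unique[of a h y c l x] that mem ac by auto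
      qed
      \<comment> \<open>the progression closes up, since \<open>- 2t = t\<close>\<close>
      have e3: "e - t - (e + t) = t"
      proof -
        have "e - t - (e + t) = t - (t + t + t)" by (simp add: algebra_simps)
        thus ?thesis using t by simp
      qed
      have key: "x = c \<or> y = a" if "s = x - y" "x \<in> A" "y \<in> A" "x \<noteq> y" for x y
        using rot[of x y e "e - t"] rot[of x y "e + t" e] rot[of x y "e - t" "e + t"] that e3 dist
        by (auto simp: ends)
      have "s = y - x" using s2 s by (metis add_eq_0_iff minus_diff_eq)
      with key[of x y] key[of y x] s xy xney ac show False by auto
    qed
    then show "a - c + t \<in> unrealised" using s0 s2 by (auto simp: unrealised_def two_torsion_def s_def)
  qed
  then show ?thesis by (intro card_inj_on_le[OF doubled_inj[OF t(1)]]) auto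
qed

text \<open>
  Fix a pair \<open>(a0, c0)\<close>.  Pairs disjoint from it inject into \<open>unrealised\<close>.  A pair that meets it is
  determined by its other entry \<open>w\<close>, because the four ways of meeting give \<open>2w - 2a0\<close> the
  values \<open>- t\<close>, \<open>- 2t\<close>, \<open>t\<close> and \<open>0\<close>, which are distinct when neither \<open>2t\<close> nor \<open>3t\<close> vanishes.
  There are only \<open>k - 5\<close> candidates for \<open>w\<close>, since the progression, \<open>a0\<close> and \<open>c0\<close> are excluded.
\<close>

lemma doubled_progression:
  assumes pr: "progression e t" and t2: "t + t \<noteq> 0" and t3: "t + t + t \<noteq> 0"
  shows "card (doubled t) + 4 \<le> card unrealised + card A"
proof (cases "doubled t = {}")
  case False
  then obtain a0 c0 where base: "(a0, c0) \<in> doubled t" by auto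
  have t0: "t \<noteq> 0" using t2 by auto
  note ends = ends_progression[OF pr t2]
  have cardE: "card (ends t) = 3" using progression_distinct[OF t2, of e] by (simp add: ends)
  define E where "E = {(a, c) \<in> doubled t - {(a0, c0)}. a = a0 \<or> a = c0 \<or> c = a0 \<or> c = c0}"
  define other where "other = (\<lambda>(a, c). if a = a0 \<or> a = c0 then c else a)"
  have base': "a0 \<in> A - ends t" "c0 \<in> A - ends t" and z0: "a0 + a0 - (c0 + c0) - t = 0"
    using base by (auto simp: doubled_def)
  have ac0: "a0 \<noteq> c0" using z0 t0 by auto
  have cases: "a = a0 \<and> w + w - (a0 + a0) = - t \<and> w = c \<or> a = c0 \<and> w + w - (a0 + a0) = - t - t \<and> w = c
      \<or> c = a0 \<and> w + w - (a0 + a0) = t \<and> w = a \<or> c = c0 \<and> w + w - (a0 + a0) = 0 \<and> w = a"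
    and W: "w \<in> A - ends t - {a0, c0}"
    if "(a, c) \<in> E" "w = other (a, c)" for a c w
  proof -
    have z: "a + a - (c + c) - t = 0" and mem: "a \<in> A - ends t" "c \<in> A - ends t"
      and nb: "(a, c) \<noteq> (a0, c0)" and or: "a = a0 \<or> a = c0 \<or> c = a0 \<or> c = c0"
      using that by (auto simp: E_def doubled_def)
    have ac: "a \<noteq> c" using z t0 by auto
    have sw: False if "a = c0" "c = a0"
    proof -
      have "t + t = - ((a + a - (c + c) - t) + (a0 + a0 - (c0 + c0) - t))"
        using that by (simp add: algebra_simps)
      thus False using z z0 t2 by simp
    qed
    have wc: "w = c \<and> (a = a0 \<or> a = c0) \<or> w = a \<and> (c = a0 \<or> c = c0) \<and> a \<noteq> a0 \<and> a \<noteq> c0"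
      using that or by (auto simp: other_def)
    then show "w \<in> A - ends t - {a0, c0}"
      using mem nb sw ac by auto
    have n1: "c + c - (a0 + a0) = - t - (a + a - (c + c) - t)" if "a = a0"
      using that by (simp add: algebra_simps)
    have v1: "c + c - (a0 + a0) = - t" if "a = a0"
      using n1[OF that] unfolding z z0 by simp
    have n2: "c + c - (a0 + a0) = - t - t - (a + a - (c + c) - t) - (a0 + a0 - (c0 + c0) - t)" if "a = c0"
      using that by (simp add: algebra_simps)
    have v2: "c + c - (a0 + a0) = - t - t" if "a = c0"
      using n2[OF that] unfolding z z0 by simp
    have n3: "a + a - (a0 + a0) = t + (a + a - (c + c) - t)" if "c = a0"
      using that by (simp add: algebra_simps)
    have v3: "a + a - (a0 + a0) = t" if "c = a0"
      using n3[OF that] unfolding z z0 by simp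
    have n4: "a + a - (a0 + a0) = (a + a - (c + c) - t) - (a0 + a0 - (c0 + c0) - t)" if "c = c0"
      using that by (simp add: algebra_simps)
    have v4: "a + a - (a0 + a0) = 0" if "c = c0"
      using n4[OF that] unfolding z z0 by simp
    show "a = a0 \<and> w + w - (a0 + a0) = - t \<and> w = c \<or> a = c0 \<and> w + w - (a0 + a0) = - t - t \<and> w = c
      \<or> c = a0 \<and> w + w - (a0 + a0) = t \<and> w = a \<or> c = c0 \<and> w + w - (a0 + a0) = 0 \<and> w = a"
      using wc v1 v2 v3 v4 by metis
  qed
  have d: "- t \<noteq> - t - t" "- t \<noteq> t" "- t \<noteq> 0" "- t - t \<noteq> t" "- t - t \<noteq> 0"
  proof -
    have "t + t = t - (- t)" "t + t = 0 - (- t - t)" "t + t + t = t - (- t - t)" by simp_all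
    then show "- t \<noteq> t" "- t - t \<noteq> 0" "- t - t \<noteq> t" using t2 t3 by (metis diff_self)+
    show "- t \<noteq> - t - t" "- t \<noteq> 0" using t0 by auto
  qed
  have "inj_on other E"
  proof (rule inj_onI)
    fix p q assume pq: "p \<in> E" "q \<in> E" "other p = other q"
    obtain a c a' c' where eqs: "p = (a, c)" "q = (a', c')" by (metis surj_pair)
    define w where "w = other (a, c)"
    have "w = other (a', c')" using pq by (simp add: w_def eqs)
    with cases[of a c w] cases[of a' c' w] pq show "p = q"
      unfolding eqs prod.inject using w_def d t0 by metis
  qed
  moreover have "other ` E \<subseteq> A - ends t - {a0, c0}" using W by auto
  ultimately have "card E \<le> card (A - ends t - {a0, c0})"
    by (intro card_inj_on_le) auto
  also have "\<dots> = card A - 5"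
  proof -
    have "ends t \<subseteq> A" by (auto simp: ends_def)
    then have "card (A - ends t) = card A - 3" by (simp add: card_Diff_subset cardE)
    then show ?thesis using base' ac0 by (simp add: card_Diff_subset)
  qed
  finally have cE: "card E \<le> card A - 5" .
  define F where "F = {(a, c) \<in> doubled t. a \<noteq> a0 \<and> a \<noteq> c0 \<and> c \<noteq> a0 \<and> c \<noteq> c0}"
  have "(\<lambda>(a, c). a - c + (c0 - a0)) ` F \<subseteq> unrealised"
  proof clarify
    fix a c assume "(a, c) \<in> F"
    moreover from this have "a \<noteq> c" using t0 by (auto simp: F_def doubled_def)
    ultimately show "a - c + (c0 - a0) \<in> unrealised"
      using doubled_disjoint_unrealised[OF _ base, of a c] ac0 by (auto simp: F_def)
  qed
  then have cF: "card F \<le> card unrealised"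
    by (intro card_inj_on_le[OF inj_on_subset[OF doubled_inj[OF t0]]]) (auto simp: F_def)
  have "doubled t \<subseteq> {(a0, c0)} \<union> E \<union> F" by (auto simp: E_def F_def)
  then have "card (doubled t) \<le> card ({(a0, c0)} \<union> E \<union> F)" by (intro card_mono) auto
  also have "\<dots> \<le> card {(a0, c0)} + card E + card F"
    by (rule order_trans[OF card_Un_le]) (rule add_right_mono, rule card_Un_le)
  finally show ?thesis using cE cF card_ge_5 by simp
qed (use card_ge_5 in simp)

section \<open>Differences of order two\<close>

definition realised :: "'a set" where
  "realised = two_torsion - unrealised"

lemma realisedE:
  assumes "s \<in> realised"
  obtains u v where "u \<in> A" "v \<in> A" "u \<noteq> v" "s = u - v" "s = v - u" "u + u = v + v"
proof -
  from assms obtain u v where uv: "u \<in> A" "v \<in> A" "s = u - v" and s: "s \<noteq> 0" "s + s = 0"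
    by (auto simp: realised_def unrealised_def two_torsion_def)
  have "u + u = v + v + (s + s)" using uv by (simp add: algebra_simps)
  then have "u + u = v + v" using s by simp
  moreover have "s = v - u" using s(2) uv(3) by (metis add_eq_0_iff minus_diff_eq)
  moreover have "u \<noteq> v" using uv s by auto
  ultimately show ?thesis using that uv by blast
qed

text \<open>
  A difference of order two equals its negative, so each unordered pair gives it twice;
  \<open>pair_sum_unique\<close> excludes further representations.
\<close>

lemma torsion_difference_fibre:
  assumes uv: "u \<in> A" "v \<in> A" "u - v \<in> two_torsion"
  shows "{(a, c). a \<in> A \<and> c \<in> A \<and> a - c = u - v} = {(u, v), (v, u)}"
proof -
  have s: "u - v \<noteq> 0" "u - v + (u - v) = 0" using uv by (auto simp: two_torsion_def)
  have sw: "u - v = v - u" using s(2) by (metis add_eq_0_iff minus_diff_eq)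
  have "a = u \<and> c = v \<or> a = v \<and> c = u" if m: "a \<in> A" "c \<in> A" "a - c = u - v" for a c
  proof (cases "a = v \<or> c = u")
    case True
    have "a - c = v - u" using m sw by simp
    with True show ?thesis by auto
  next
    case False
    have "a + v = u + c" using m(3) by (simp add: algebra_simps)
    with pair_sum_unique[of a v u c] False m uv s show ?thesis by auto
  qed
  moreover have "v - u = u - v" using sw by simp
  ultimately show ?thesis using uv by auto
qed

lemma card_torsion_difference_fibre_le:
  assumes "s \<in> two_torsion"
  shows "card {(a, c). a \<in> A \<and> c \<in> A \<and> a - c = s} \<le> 2"
proof (cases "{(a, c). a \<in> A \<and> c \<in> A \<and> a - c = s} = {}")
  case False
  then obtain u v where "u \<in> A" "v \<in> A" "s = u - v" by auto
  then have "{(a, c). a \<in> A \<and> c \<in> A \<and> a - c = s} = {(u, v), (v, u)}"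
    using torsion_difference_fibre assms by simp
  moreover have "card {(u, v), (v, u)} \<le> 2" by (rule card_insert_le_m1) simp_all
  ultimately show ?thesis by (simp only:)
next
  case True
  then show ?thesis by (simp only: card.empty)
qed

definition torsion_pairs :: "('a \<times> 'a) set" where
  "torsion_pairs = {(a, c). a \<in> A \<and> c \<in> A \<and> a \<noteq> c \<and> a + a = c + c}"

lemma card_torsion_pairs: "card torsion_pairs = 2 * card realised"
proof -
  define F where "F s = {(a, c). a \<in> A \<and> c \<in> A \<and> a - c = s}" for s
  have "torsion_pairs = (\<Union>s\<in>realised. F s)"
  proof (intro equalityI subsetI; clarify)
    fix a c assume "(a, c) \<in> torsion_pairs"
    then have m: "a \<in> A" "c \<in> A" "a \<noteq> c" "a + a = c + c" by (auto simp: torsion_pairs_def)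
    have "a - c + (a - c) = a + a - (c + c)" by (simp add: algebra_simps)
    then have "a - c \<in> realised" using m by (auto simp: realised_def unrealised_def two_torsion_def)
    then show "(a, c) \<in> (\<Union>s\<in>realised. F s)" using m by (auto simp: F_def)
  next
    fix a c s assume s: "s \<in> realised" and "(a, c) \<in> F s"
    then have m: "a \<in> A" "c \<in> A" "a - c = s" by (auto simp: F_def)
    have "a - c + (a - c) = a + a - (c + c)" by (simp add: algebra_simps)
    then show "(a, c) \<in> torsion_pairs"
      using m s by (auto simp: torsion_pairs_def realised_def two_torsion_def)
  qed
  also have "card \<dots> = (\<Sum>s\<in>realised. card (F s))"
    by (rule card_UN_disjoint) (auto simp: F_def)
  also have "\<dots> = (\<Sum>s\<in>realised. 2)"
  proof (rule sum.cong[OF refl])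
    fix s assume "s \<in> realised"
    then obtain u v where "u \<in> A" "v \<in> A" "u \<noteq> v" "s = u - v" by (rule realisedE)
    then have "F s = {(u, v), (v, u)}"
      using torsion_difference_fibre \<open>s \<in> realised\<close> by (simp add: F_def realised_def)
    then show "card (F s) = 2" using \<open>u \<noteq> v\<close> by simp
  qed
  finally show ?thesis by simp
qed

text \<open>
  Fix one realised element \<open>p - q\<close>.  A realised element whose pair is disjoint from \<open>{p, q}\<close>
  becomes unrealised when \<open>p - q\<close> is added.  The pairs that meet \<open>{p, q}\<close> have their other
  entry in the class \<open>C\<close> of further elements with the same double as \<open>p\<close>, and with \<open>r = |C|\<close> there are
  \<open>2r\<close> of them.  The class in turn has \<open>r(r - 1)/2\<close> unordered pairs, which are disjoint
  from \<open>{p, q}\<close> and so lead to as many unrealised elements.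
\<close>

lemma realised_bound:
  obtains r where "card realised \<le> 1 + 2 * r + card unrealised" "r * (r - 1) \<le> 2 * card unrealised"
proof (cases "realised = {}")
  case True
  then show ?thesis using that[of 0] by simp
next
  case False
  then obtain s0 where "s0 \<in> realised" by auto
  then obtain p q where pq: "p \<in> A" "q \<in> A" "p \<noteq> q" "s0 = p - q" "s0 = q - p" "p + p = q + q"
    by (rule realisedE)
  define C where "C = {x \<in> A - {p, q}. x + x = p + p}"
  have "realised \<subseteq> {s0} \<union> (\<lambda>w. p - w) ` C \<union> (\<lambda>w. q - w) ` C \<union> (\<lambda>s. s - s0) ` unrealised"
  proof
    fix s assume "s \<in> realised"
    then obtain u v where uv: "u \<in> A" "v \<in> A" "u \<noteq> v" "s = u - v" "s = v - u" "u + u = v + v"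
      by (rule realisedE)
    consider "s = s0" | "u = p" "v \<in> C" | "v = p" "u \<in> C" | "u = q" "v \<in> C" | "v = q" "u \<in> C"
      | "u \<notin> {p, q}" "v \<notin> {p, q}"
      by (cases "u = p"; cases "u = q"; cases "v = p"; cases "v = q") (use uv pq in \<open>auto simp: C_def\<close>)
    then show "s \<in> {s0} \<union> (\<lambda>w. p - w) ` C \<union> (\<lambda>w. q - w) ` C \<union> (\<lambda>s. s - s0) ` unrealised"
    proof cases
      case 6
      then have "u - v + (p - q) \<in> unrealised"
        by (intro disjoint_torsion_pairs) (use uv pq in auto)
      then have "s + s0 \<in> unrealised" using uv(4) pq(4) by simp
      then have "s + s0 - s0 \<in> (\<lambda>s. s - s0) ` unrealised" by (rule imageI)
      then show ?thesis by simp
    next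
      case 1
      then show ?thesis by blast
    next
      case 2
      then show ?thesis using uv(4) by blast
    next
      case 3
      then show ?thesis using uv(5) by blast
    next
      case 4
      then show ?thesis using uv(4) by blast
    next
      case 5
      then show ?thesis using uv(5) by blast
    qed
  qed
  then have "card realised \<le> card ({s0} \<union> (\<lambda>w. p - w) ` C \<union> (\<lambda>w. q - w) ` C \<union> (\<lambda>s. s - s0) ` unrealised)"
    by (intro card_mono) auto
  also have "\<dots> \<le> card {s0} + card ((\<lambda>w. p - w) ` C) + card ((\<lambda>w. q - w) ` C) + card ((\<lambda>s. s - s0) ` unrealised)"
    by (rule order_trans[OF card_Un_le], rule add_right_mono,
        rule order_trans[OF card_Un_le], rule add_right_mono, rule card_Un_le)
  also have "\<dots> \<le> 1 + card C + card C + card unrealised"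
    by (intro add_mono card_image_le) auto
  finally have 1: "card realised \<le> 1 + 2 * card C + card unrealised" by simp
  define P where "P = {(w, w'). w \<in> C \<and> w' \<in> C \<and> w \<noteq> w'}"
  have unrealised: "w - w' + (p - q) \<in> unrealised" if "w \<in> C" "w' \<in> C" "w \<noteq> w'" for w w'
    by (rule disjoint_torsion_pairs) (use that pq in \<open>auto simp: C_def\<close>)
  have sub: "(\<lambda>(w, w'). w - w' + (p - q)) ` P \<subseteq> unrealised"
    using unrealised by (auto simp: P_def)
  have "card P \<le> 2 * card ((\<lambda>(w, w'). w - w' + (p - q)) ` P)"
  proof (rule card_le_fibre_bound)
    fix y assume "y \<in> (\<lambda>(w, w'). w - w' + (p - q)) ` P"
    then obtain w w' where w: "w \<in> C" "w' \<in> C" "w \<noteq> w'" "y = w - w' + (p - q)"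
      by (auto simp: P_def)
    have "w - w' + (w - w') = w + w - (w' + w')" by (simp add: algebra_simps)
    also have "\<dots> = 0" using w by (simp add: C_def)
    finally have "w - w' \<in> two_torsion" using w by (simp add: two_torsion_def)
    then have "card {(a, c). a \<in> A \<and> c \<in> A \<and> a - c = w - w'} \<le> 2"
      by (rule card_torsion_difference_fibre_le)
    moreover have "{x \<in> P. (case x of (w, w') \<Rightarrow> w - w' + (p - q)) = y}
        \<subseteq> {(a, c). a \<in> A \<and> c \<in> A \<and> a - c = w - w'}"
      using w by (auto simp: P_def C_def)
    ultimately show "card {x \<in> P. (case x of (w, w') \<Rightarrow> w - w' + (p - q)) = y} \<le> 2"
      by (meson card_mono finite le_trans)
  qed simp
  also have "\<dots> \<le> 2 * card unrealised" using sub by (intro mult_left_mono card_mono) auto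
  finally have "card C * (card C - 1) \<le> 2 * card unrealised"
    using card_off_diagonal[of C] by (simp add: P_def)
  with 1 show ?thesis using that by blast
qed

section \<open>Three-term progressions\<close>

definition midpoints :: "'a set" where
  "midpoints = {e. \<exists>t. progression e t \<and> t + t \<noteq> 0 \<and> t + t + t \<noteq> 0}"

text \<open>
  When \<open>3t = 0\<close>, the progression is a coset of a subgroup of order three and each of its three terms is
  a midpoint.  These progressions are treated separately, because then \<open>t\<close> has three
  representations as a difference of \<open>A\<close> instead of two.
\<close>

definition coset_midpoints :: "'a set" where
  "coset_midpoints = {e. \<exists>t. progression e t \<and> t \<noteq> 0 \<and> t + t + t = 0}"

text \<open>
  Both progressions give \<open>2e\<close> as the sum of two distinct elements of \<open>A\<close>.
\<close>

lemma progression_unique: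
  assumes "progression e t" "progression e t'" "t + t \<noteq> 0" "t' + t' \<noteq> 0"
  shows "t' = t \<or> t' = - t"
proof -
  have "(e - t) + (e + t) = (e - t') + (e + t')" by (simp add: algebra_simps)
  from pair_sum_unique[OF this] have "e - t = e - t' \<or> e - t = e + t'"
    using assms progression_distinct(3)[of t e] progression_distinct(3)[of t' e]
    by (auto simp: progression_def)
  moreover have "t' = t" if "e - t = e - t'"
    using that by simp
  moreover have "t' = - t" if "e - t = e + t'"
    using that by (metis add_left_cancel diff_conv_add_uminus)
  ultimately show ?thesis by blast
qed

lemma card_progression_differences_le: "card {t. progression e t \<and> t + t \<noteq> 0} \<le> 2"
proof (cases "{t. progression e t \<and> t + t \<noteq> 0} = {}")
  case False
  then obtain t where "progression e t" "t + t \<noteq> 0" by auto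
  then have "{t. progression e t \<and> t + t \<noteq> 0} \<subseteq> {t, - t}"
    using progression_unique[of e t] by blast
  then have "card {t. progression e t \<and> t + t \<noteq> 0} \<le> card {t, - t}" by (intro card_mono) auto
  also have "\<dots> \<le> 2" by (rule card_insert_le_m1) simp_all
  finally show ?thesis .
next
  case True
  then show ?thesis by (simp only: card.empty)
qed

lemma midpoints_disjoint: "midpoints \<inter> coset_midpoints = {}"
proof -
  have False if "progression e t" "t + t \<noteq> 0" "t + t + t \<noteq> 0"
    and "progression e t'" "t' \<noteq> 0" "t' + t' + t' = 0" for e t t'
  proof -
    have "t' + t' \<noteq> 0" using that by auto
    from progression_unique[OF that(1,4,2) this] have "t' = t \<or> t' = - t" .
    moreover have "- t + - t + - t = - (t + t + t)" by (simp add: algebra_simps)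
    ultimately show False using that by (metis neg_equal_0_iff_equal)
  qed
  then show ?thesis by (auto simp: midpoints_def coset_midpoints_def)
qed

definition steps :: "'a set" where
  "steps = {t. t + t \<noteq> 0 \<and> t + t + t \<noteq> 0 \<and> (\<exists>e. progression e t)}"

definition coset_steps :: "'a set" where
  "coset_steps = {t. t \<noteq> 0 \<and> t + t + t = 0 \<and> (\<exists>e. progression e t)}"

lemma card_steps: "card steps \<le> card midpoints * 2"
proof -
  have "card steps \<le> card (\<Union>e\<in>midpoints. {t. progression e t \<and> t + t \<noteq> 0})"
    by (intro card_mono) (auto simp: steps_def midpoints_def)
  also have "\<dots> \<le> card midpoints * 2"
    by (intro card_UN_le_mult card_progression_differences_le) simp
  finally show ?thesis .
qed

text \<open>
  Double counting of incidences: a midpoint belongs to at most two steps \<open>\<plusminus> t\<close>, while a step belongs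
  to at least the two midpoints \<open>e\<close> and \<open>e + t\<close> of its coset.
\<close>

lemma card_coset_steps: "card coset_steps \<le> card coset_midpoints"
proof -
  have tt: "t + t \<noteq> 0" if "t \<in> coset_steps" for t using that by (auto simp: coset_steps_def)
  have "2 * card coset_steps \<le> (\<Sum>t\<in>coset_steps. card {e. progression e t})"
  proof -
    have "2 \<le> card {e. progression e t}" if t: "t \<in> coset_steps" for t
    proof -
      obtain e where e: "progression e t" using t by (auto simp: coset_steps_def)
      have "e + t + t = e - t + (t + t + t)" by (simp add: algebra_simps)
      moreover have "t + t + t = 0" using t by (simp add: coset_steps_def)
      ultimately have "e + t + t = e - t" by (simp only: add_0_right)
      then have "progression (e + t) t"
        using e unfolding progression_def by (simp only: add_diff_cancel_right' simp_thms)
      then have "{e, e + t} \<subseteq> {e. progression e t}" using e by blast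
      then have "card {e, e + t} \<le> card {e. progression e t}" by (intro card_mono) auto
      moreover have "card {e, e + t} = 2" using t by (simp add: coset_steps_def)
      ultimately show ?thesis by simp
    qed
    then have "of_nat (card coset_steps) * (2::nat) \<le> (\<Sum>t\<in>coset_steps. card {e. progression e t})"
      by (rule sum_bounded_below)
    then show ?thesis by simp
  qed
  also have "\<dots> = card (Sigma coset_steps (\<lambda>t. {e. progression e t}))"
    by (simp add: card_SigmaI)
  also have "\<dots> = card ((\<lambda>(t, e). (e, t)) ` Sigma coset_steps (\<lambda>t. {e. progression e t}))"
    by (rule card_image[symmetric]) (auto simp: inj_on_def)
  also have "\<dots> \<le> card (Sigma coset_midpoints (\<lambda>e. {t. progression e t \<and> t + t \<noteq> 0}))"
    using tt by (intro card_mono) (auto simp: coset_steps_def coset_midpoints_def)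
  also have "\<dots> = (\<Sum>e\<in>coset_midpoints. card {t. progression e t \<and> t + t \<noteq> 0})"
    by (simp add: card_SigmaI)
  also have "\<dots> \<le> of_nat (card coset_midpoints) * 2"
    by (rule sum_bounded_above) (rule card_progression_differences_le)
  finally show ?thesis by simp
qed

section \<open>Relations of the form 2a + b = 2c + e\<close>

definition generic_pairs :: "('a \<times> 'a) set" where
  "generic_pairs = {(a, c). a \<in> A \<and> c \<in> A \<and> a + a \<noteq> c + c}"

definition doubled_over :: "'a set \<Rightarrow> ('a \<times> 'a) set" where
  "doubled_over T = (\<Union>t\<in>T. doubled t)"

text \<open>
  For a pair \<open>(a, c)\<close>, these are the \<open>b\<close> that occur in a relation \<open>2a + b = 2c + e\<close> with \<open>b\<close> and
  \<open>e\<close> outside \<open>{a, c}\<close>.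
\<close>

definition shifts :: "'a \<times> 'a \<Rightarrow> 'a set" where
  "shifts = (\<lambda>(a, c). {b \<in> A - {a, c}. b + (a + a - (c + c)) \<in> A - {a, c}})"

lemma card_generic_pairs:
  "card generic_pairs + 2 * card realised = card A * (card A - 1)"
proof -
  have "{(a, c). a \<in> A \<and> c \<in> A \<and> a \<noteq> c} = generic_pairs \<union> torsion_pairs"
    by (auto simp: generic_pairs_def torsion_pairs_def)
  moreover have "generic_pairs \<inter> torsion_pairs = {}"
    by (auto simp: generic_pairs_def torsion_pairs_def)
  ultimately have "card A * (card A - 1) = card generic_pairs + card torsion_pairs"
    using card_off_diagonal[of A] by (simp add: card_Un_disjoint)
  then show ?thesis by (simp add: card_torsion_pairs)
qed

text \<open>
  By \<open>equal_differences_adjacent\<close>, two admissible values of \<open>b\<close> are consecutive, so \<open>b\<close>, \<open>b + t\<close>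
  and \<open>b + 2t\<close> all lie in \<open>A\<close> and avoid \<open>a\<close> and \<open>c\<close>.  If \<open>2t = 0\<close>, these are two elements whose difference
  \<open>t\<close> has order two, and otherwise they form a progression.  A third admissible value
  requires \<open>3t = 0\<close>.
\<close>

lemma card_shifts:
  assumes p: "p \<in> generic_pairs"
  shows "card (shifts p) \<le> 1 + of_bool (p \<in> doubled_over realised) + of_bool (p \<in> doubled_over steps)
    + 2 * of_bool (p \<in> doubled_over coset_steps)"
proof (cases "card (shifts p) \<le> 1")
  case False
  obtain a c where ac: "p = (a, c)" by (cases p)
  define t where "t = a + a - (c + c)"
  have mem: "a \<in> A" "c \<in> A" and t0: "t \<noteq> 0" using p by (auto simp: generic_pairs_def ac t_def)
  have sh: "shifts p = {b \<in> A - {a, c}. b + t \<in> A - {a, c}}" by (simp add: shifts_def ac t_def)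
  obtain b where b: "b \<in> shifts p" "b + t \<in> shifts p"
  proof -
    from False obtain x y where xy: "x \<in> shifts p" "y \<in> shifts p" "x \<noteq> y"
      by (metis One_nat_def card_le_Suc0_iff_eq finite)
    then have "y = x + t \<or> x = y + t"
      using equal_differences_adjacent[of x t y] t0 by (auto simp: sh)
    then show ?thesis using that xy by auto
  qed
  then have B: "b \<in> A" "b + t \<in> A" "b + t + t \<in> A" "a \<notin> {b, b + t, b + t + t}" "c \<notin> {b, b + t, b + t + t}"
    by (auto simp: sh)
  have sub: "shifts p \<subseteq> ends t" by (auto simp: sh ends_def)
  show ?thesis
  proof (cases "t + t = 0")
    case True
    have bt: "b + t + t = b" using True by (simp add: add.assoc)
    have neg: "x - t = x + t" for x using True by (metis add_diff_cancel_right' add.assoc add_0_right)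
    have ends: "ends t \<subseteq> {b, b + t}"
    proof
      fix v assume "v \<in> ends t"
      then have "v \<in> A" "v + t \<in> A" by (auto simp: ends_def neg)
      then have "v = b \<or> v = b + t \<or> b = v + t"
        using equal_differences_adjacent[of b t v] B t0 by simp
      moreover have "v + t + t = v" using True by (simp add: add.assoc)
      ultimately show "v \<in> {b, b + t}" by auto
    qed
    have "t = b + t - b" by simp
    then have "t \<in> realised" using B True t0 by (fastforce simp: realised_def unrealised_def two_torsion_def)
    moreover have "p \<in> doubled t" using B ends mem by (auto simp: doubled_def ac t_def)
    ultimately have "p \<in> doubled_over realised" by (auto simp: doubled_over_def)
    moreover have "card (shifts p) \<le> card {b, b + t}" using sub ends by (intro card_mono) auto
    ultimately show ?thesis using t0 by simp
  next
    case False
    have pr: "progression (b + t) t" using B by (simp add: progression_def)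
    have ends: "ends t = {b, b + t, b + t + t}" using ends_progression[OF pr False] by simp
    have dbl: "p \<in> doubled t" using B ends mem by (auto simp: doubled_def ac t_def)
    show ?thesis
    proof (cases "t + t + t = 0")
      case True
      then have "t \<in> coset_steps" using t0 pr by (auto simp: coset_steps_def)
      then have "p \<in> doubled_over coset_steps" using dbl by (auto simp: doubled_over_def)
      moreover have "card (shifts p) \<le> card {b, b + t, b + t + t}" using sub ends by (intro card_mono) auto
      moreover have "card {b, b + t, b + t + t} \<le> 3" by (simp add: card_insert_if)
      ultimately show ?thesis by simp
    next
      case t3: False
      then have "t \<in> steps" using False pr by (auto simp: steps_def)
      then have "p \<in> doubled_over steps" using dbl by (auto simp: doubled_over_def)
      have "b + t + t \<notin> shifts p"
      proof
        assume "b + t + t \<in> shifts p"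
        then have "b + t + t + t \<in> ends t"
          by (auto simp: sh ends_def)
        then show False using t0 False t3 by (auto simp: ends add.assoc)
      qed
      then have "shifts p \<subseteq> {b, b + t}" using sub ends by auto
      then have "card (shifts p) \<le> card {b, b + t}" by (intro card_mono) auto
      then show ?thesis using t0 \<open>p \<in> doubled_over steps\<close> by simp
    qed
  qed
qed simp

lemma doubled_over_subset_generic: "0 \<notin> T \<Longrightarrow> doubled_over T \<subseteq> generic_pairs"
  by (auto simp: doubled_over_def doubled_def generic_pairs_def)

lemma doubled_over_disjoint: "T \<inter> T' = {} \<Longrightarrow> doubled_over T \<inter> doubled_over T' = {}"
  by (auto simp: doubled_over_def doubled_def)

lemma sum_card_shifts:
  "(\<Sum>p\<in>generic_pairs. card (shifts p))
    \<le> card generic_pairs + card (doubled_over realised) + card (doubled_over steps) + 2 * card (doubled_over coset_steps)"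
proof -
  have z: "0 \<notin> realised" "0 \<notin> steps" "0 \<notin> coset_steps"
    by (auto simp: realised_def two_torsion_def steps_def coset_steps_def)
  have "(\<Sum>p\<in>generic_pairs. card (shifts p))
      \<le> (\<Sum>p\<in>generic_pairs. 1 + of_bool (p \<in> doubled_over realised) + of_bool (p \<in> doubled_over steps)
          + 2 * of_bool (p \<in> doubled_over coset_steps))"
    by (rule sum_mono) (rule card_shifts)
  also have "\<dots> = card generic_pairs + card (generic_pairs \<inter> doubled_over realised)
      + card (generic_pairs \<inter> doubled_over steps) + 2 * card (generic_pairs \<inter> doubled_over coset_steps)"
    unfolding sum.distrib sum_distrib_left[symmetric] by (simp add: Int_def)
  also have "\<dots> = card generic_pairs + card (doubled_over realised) + card (doubled_over steps) + 2 * card (doubled_over coset_steps)"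
    using z by (simp add: Int_absorb1[OF doubled_over_subset_generic])
  finally show ?thesis .
qed

lemma card_doubled_over_disjoint_sum:
  "card (doubled_over realised) + card (doubled_over steps) + card (doubled_over coset_steps) \<le> card generic_pairs"
proof -
  have z: "0 \<notin> realised" "0 \<notin> steps" "0 \<notin> coset_steps"
    by (auto simp: realised_def two_torsion_def steps_def coset_steps_def)
  have d: "realised \<inter> steps = {}" "realised \<inter> coset_steps = {}" "steps \<inter> coset_steps = {}"
    by (auto simp: realised_def two_torsion_def steps_def coset_steps_def)
  have "card (doubled_over realised) + card (doubled_over steps) + card (doubled_over coset_steps)
      = card (doubled_over realised \<union> doubled_over steps \<union> doubled_over coset_steps)"
    using d[THEN doubled_over_disjoint] by (simp add: card_Un_disjoint Int_Un_distrib2)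
  also have "\<dots> \<le> card generic_pairs"
    using z[THEN doubled_over_subset_generic] by (intro card_mono) auto
  finally show ?thesis .
qed

lemma card_doubled_over_realised: "card (doubled_over realised) \<le> card realised * (2 * (1 + card unrealised))"
  unfolding doubled_over_def
proof (rule card_UN_le_mult)
  fix t assume t: "t \<in> realised"
  then obtain u v where "u \<in> A" "v \<in> A" "t = u - v" by (rule realisedE)
  then show "card (doubled t) \<le> 2 * (1 + card unrealised)"
    using t by (intro doubled_order_two) (auto simp: realised_def two_torsion_def)
qed simp

lemma card_doubled_over_steps: "card (doubled_over steps) \<le> card midpoints * 2 * (card unrealised + card A - 4)"
proof -
  have "card (doubled_over steps) \<le> card steps * (card unrealised + card A - 4)"
    unfolding doubled_over_def
  proof (rule card_UN_le_mult)
    fix t assume "t \<in> steps"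
    then obtain e where "progression e t" "t + t \<noteq> 0" "t + t + t \<noteq> 0" by (auto simp: steps_def)
    from doubled_progression[OF this] show "card (doubled t) \<le> card unrealised + card A - 4" by simp
  qed simp
  also have "\<dots> \<le> card midpoints * 2 * (card unrealised + card A - 4)"
    by (intro mult_right_mono card_steps) simp
  finally show ?thesis .
qed

lemma card_doubled_over_coset_steps: "card (doubled_over coset_steps) \<le> card coset_midpoints * card unrealised"
proof -
  have "card (doubled_over coset_steps) \<le> card coset_steps * card unrealised"
    unfolding doubled_over_def
  proof (rule card_UN_le_mult)
    fix t assume "t \<in> coset_steps"
    then obtain e where "progression e t" "t \<noteq> 0" "t + t + t = 0" by (auto simp: coset_steps_def)
    from doubled_order_three[OF this] show "card (doubled t) \<le> card unrealised" .
  qed simp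
  also have "\<dots> \<le> card coset_midpoints * card unrealised"
    by (intro mult_right_mono card_coset_steps) simp
  finally show ?thesis .
qed

section \<open>Values of a + b - c\<close>

definition triples :: "('a \<times> 'a \<times> 'a) set" where
  "triples = {(a, b, c). a \<in> A \<and> b \<in> A \<and> c \<in> A \<and> a \<noteq> b \<and> c \<noteq> a \<and> c \<noteq> b}"

text \<open>
  Recording only the value and the subtracted element identifies the expressions \<open>a + b - c\<close> and \<open>b + a - c\<close>,
  and nothing else, as \<open>card_triples_le_reps\<close> shows.
\<close>

definition reps :: "('a \<times> 'a) set" where
  "reps = (\<lambda>(a, b, c). (a + b - c, c)) ` triples"

lemma card_triples: "card triples = card A * (card A - 1) * (card A - 2)"
proof -
  have "triples = Sigma A (\<lambda>a. Sigma (A - {a}) (\<lambda>b. A - {a, b}))" by (auto simp: triples_def)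
  moreover have "card (Sigma (A - {a}) (\<lambda>b. A - {a, b})) = (card A - 1) * (card A - 2)" if "a \<in> A" for a
  proof -
    have "card (A - {a, b}) = card A - 2" if "b \<in> A - {a}" for b
      using that \<open>a \<in> A\<close> by (auto simp: card_Diff_subset card_insert_if)
    then show ?thesis using that by (simp add: card_SigmaI)
  qed
  ultimately show ?thesis by (simp add: card_SigmaI)
qed

lemma card_triples_le_reps: "card triples \<le> 2 * card reps"
  unfolding reps_def
proof (rule card_le_fibre_bound)
  fix y assume "y \<in> (\<lambda>(a, b, c). (a + b - c, c)) ` triples"
  then obtain a b c where abc: "(a, b, c) \<in> triples" "y = (a + b - c, c)" by auto
  have "(a', b', c') \<in> {(a, b, c), (b, a, c)}"
    if m: "(a', b', c') \<in> triples" and e: "(a' + b' - c', c') = y" for a' b' c'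
  proof -
    have "c' = c" "a' + b' = a + b" using e abc by auto
    with pair_sum_unique[OF this(2)] abc m show ?thesis by (auto simp: triples_def)
  qed
  then have "{x \<in> triples. (case x of (a, b, c) \<Rightarrow> (a + b - c, c)) = y} \<subseteq> {(a, b, c), (b, a, c)}"
    by (clarsimp simp only: mem_Collect_eq split_paired_all split_conv subset_iff) blast
  then have "card {x \<in> triples. (case x of (a, b, c) \<Rightarrow> (a + b - c, c)) = y} \<le> card {(a, b, c), (b, a, c)}"
    by (intro card_mono) auto
  also have "\<dots> \<le> 2" by (rule card_insert_le_m1) simp_all
  finally show "card {x \<in> triples. (case x of (a, b, c) \<Rightarrow> (a + b - c, c)) = y} \<le> 2" .
qed simp

section \<open>Relations of the form 2a + b = c + d + e\<close>

definition sum_members :: "'a \<times> 'a \<Rightarrow> 'a set" where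
  "sum_members = (\<lambda>(a, b). {c \<in> A - {a, b}. \<exists>d\<in>A - {a, c}. \<exists>e\<in>A - {a, c, d}. a + a + b = c + d + e})"

definition one_sided :: "(('a \<times> 'a) \<times> 'a) set" where
  "one_sided = Sigma {(a, b). a \<in> A \<and> b \<in> A \<and> a \<noteq> b} sum_members"

text \<open>
  For these \<open>(a, b)\<close> the sum \<open>2a + b = (a - t) + (a + t) + b\<close> has \<open>b\<close> itself among its three
  summands.
\<close>

definition off_progression :: "('a \<times> 'a) set" where
  "off_progression = {(a, b). \<exists>t. progression a t \<and> t + t \<noteq> 0 \<and> b \<in> A - {a - t, a, a + t}}"

text \<open>
  The sum \<open>2a + b\<close> determines the three-element set that contains \<open>c\<close>.  If \<open>b\<close> belongs to that set,
  it is not available as \<open>c\<close>.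
\<close>

lemma card_sum_members:
  assumes "a \<in> A" "b \<in> A" "a \<noteq> b"
  shows "card (sum_members (a, b)) + of_bool ((a, b) \<in> off_progression) \<le> 3"
proof (cases "(a, b) \<in> off_progression")
  case True
  then obtain t where t: "progression a t" "t + t \<noteq> 0" "b \<in> A - {a - t, a, a + t}"
    by (auto simp: off_progression_def)
  have "sum_members (a, b) \<subseteq> {a - t, a + t}"
  proof
    fix c assume "c \<in> sum_members (a, b)"
    then obtain d e where cde: "c \<in> A - {a, b}" "d \<in> A - {a, c}" "e \<in> A - {a, c, d}" "a + a + b = c + d + e"
      by (auto simp: sum_members_def)
    have "(a - t) + (a + t) + b = c + d + e" using cde(4) by (simp add: algebra_simps)
    then have "{a - t, a + t, b} = {c, d, e}"
      by (rule triple_sum_unique) (use t cde progression_distinct(3)[OF t(2), of a] in \<open>auto simp: progression_def\<close>)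
    then show "c \<in> {a - t, a + t}" using cde(1) by blast
  qed
  then have "card (sum_members (a, b)) \<le> card {a - t, a + t}" by (intro card_mono) auto
  also have "\<dots> \<le> 2" by (rule card_insert_le_m1) simp_all
  finally show ?thesis using True by simp
next
  case False
  show ?thesis
  proof (cases "sum_members (a, b) = {}")
    case True
    then show ?thesis using False by simp
  next
    case ne: False
    then obtain c d e where cde: "c \<in> A - {a, b}" "d \<in> A - {a, c}" "e \<in> A - {a, c, d}" "a + a + b = c + d + e"
      by (auto simp: sum_members_def)
    have "sum_members (a, b) \<subseteq> {c, d, e}"
    proof
      fix c' assume "c' \<in> sum_members (a, b)"
      then obtain d' e' where cde': "c' \<in> A - {a, b}" "d' \<in> A - {a, c'}" "e' \<in> A - {a, c', d'}" "a + a + b = c' + d' + e'"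
        by (auto simp: sum_members_def)
      have "{c', d', e'} = {c, d, e}"
        by (rule triple_sum_unique) (use cde cde' in auto)
      then show "c' \<in> {c, d, e}" by blast
    qed
    then have "card (sum_members (a, b)) \<le> card {c, d, e}" by (intro card_mono) auto
    also have "\<dots> \<le> 3" by (simp add: card_insert_if)
    finally show ?thesis using False by simp
  qed
qed

lemma card_off_progression:
  "card (midpoints \<union> coset_midpoints) * (card A - 3) \<le> card off_progression"
proof -
  let ?N = "midpoints \<union> coset_midpoints"
  have "of_nat (card ?N) * (card A - 3) \<le> (\<Sum>a\<in>?N. card {b. (a, b) \<in> off_progression})"
  proof (rule sum_bounded_below)
    fix a assume "a \<in> ?N"
    then obtain t where t: "progression a t" "t + t \<noteq> 0"
      unfolding midpoints_def coset_midpoints_def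
      by (smt (verit) Un_iff add_0_left mem_Collect_eq)
    have "{a - t, a, a + t} \<subseteq> A" using t by (simp add: progression_def)
    then have "card A - 3 = card (A - {a - t, a, a + t})"
      using progression_distinct[OF t(2), of a] by (simp add: card_Diff_subset)
    also have "\<dots> \<le> card {b. (a, b) \<in> off_progression}"
      using t by (intro card_mono) (auto simp: off_progression_def)
    finally show "card A - 3 \<le> card {b. (a, b) \<in> off_progression}" .
  qed
  also have "\<dots> = card (Sigma ?N (\<lambda>a. {b. (a, b) \<in> off_progression}))"
    by (simp add: card_SigmaI)
  also have "\<dots> \<le> card off_progression" by (intro card_mono) auto
  finally show ?thesis by simp
qed

lemma card_one_sided:
  "card one_sided + card (midpoints \<union> coset_midpoints) * (card A - 3) \<le> 3 * (card A * (card A - 1))"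
proof -
  let ?P = "{(a, b). a \<in> A \<and> b \<in> A \<and> a \<noteq> b}"
  have "off_progression \<subseteq> ?P" by (auto simp: off_progression_def progression_def)
  then have "card off_progression = (\<Sum>p\<in>?P. of_bool (p \<in> off_progression))"
    by (simp add: Int_absorb1 Collect_conj_eq[symmetric] Int_def[symmetric])
  then have "card one_sided + card off_progression
      = (\<Sum>p\<in>?P. card (sum_members p) + of_bool (p \<in> off_progression))"
    by (simp add: one_sided_def card_SigmaI sum.distrib)
  also have "\<dots> \<le> of_nat (card ?P) * 3"
  proof (rule sum_bounded_above)
    fix p assume "p \<in> ?P"
    then show "card (sum_members p) + of_bool (p \<in> off_progression) \<le> 3"
      using card_sum_members by (cases p) blast
  qed
  also have "\<dots> = 3 * (card A * (card A - 1))" using card_off_diagonal[of A] by simp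
  finally show ?thesis using card_off_progression by linarith
qed

section \<open>Collisions between values\<close>

definition collisions :: "('a \<times> 'a \<times> 'a) set" where
  "collisions = {(x, c, c'). (x, c) \<in> reps \<and> (x, c') \<in> reps \<and> c \<noteq> c'}"

text \<open>
  Adding \<open>c + c'\<close> to both sides gives \<open>2c' + b = c + d + e\<close>, and \<open>c\<close>, \<open>d\<close>, \<open>e\<close> are
  distinct because \<open>c\<close> does not cancel.
\<close>

lemma collision_one_sided:
  assumes "(c', b, c) \<in> triples" "(d, e, c') \<in> triples" "c \<notin> {d, e}"
    and "c' + b - c = d + e - c'"
  shows "((c', b), c) \<in> one_sided"
proof -
  have "c' + c' + b = (c' + b - c) + c + c'" by (simp add: algebra_simps)
  also have "\<dots> = c + d + e" by (simp only: assms(4)) (simp add: algebra_simps)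
  finally have "c' + c' + b = c + d + e" .
  moreover have "d \<in> A - {c', c}" "e \<in> A - {c', c, d}" using assms by (auto simp: triples_def)
  ultimately have "\<exists>d\<in>A - {c', c}. \<exists>e\<in>A - {c', c, d}. c' + c' + b = c + d + e" by blast
  then show ?thesis
    using assms(1) by (simp add: one_sided_def sum_members_def triples_def)
qed

text \<open>
  Here both subtracted elements reappear, which gives \<open>2c' + b = 2c + e\<close>.  If \<open>2c' = 2c\<close>, then
  \<open>b = e\<close> is arbitrary; otherwise \<open>b\<close> determines \<open>e\<close>.
\<close>

lemma collision_two_sided:
  assumes m: "(c', b, c) \<in> triples" "(c, e, c') \<in> triples"
    and eq: "c' + b - c = c + e - c'"
  shows "((c', c), b) \<in> Sigma generic_pairs shifts
    \<or> ((c', c), b) \<in> Sigma torsion_pairs (\<lambda>(a, c). A - {a, c})"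
proof (cases "c' + c' = c + c")
  case True
  then show ?thesis using m by (auto simp: torsion_pairs_def triples_def)
next
  case False
  have "b + (c' + c' - (c + c)) = (c' + b - c) - c + c'" by (simp add: algebra_simps)
  also have "\<dots> = e" by (simp only: eq) (simp add: algebra_simps)
  finally show ?thesis using False m by (auto simp: generic_pairs_def shifts_def triples_def)
qed

text \<open>
  If neither subtracted element occurred on the other side, \<open>a + b + c' = d + e + c\<close> would be an equation
  between sums of three distinct elements, and \<open>c\<close> would lie in \<open>{a, b, c'}\<close>.
\<close>

lemma collisions_cover:
  "collisions \<subseteq> (\<lambda>((a, b), c). (a + b - c, c, a)) ` one_sided
    \<union> (\<lambda>((a, b), c). (a + b - c, a, c)) ` one_sided
    \<union> (\<lambda>((a, c), b). (a + b - c, c, a)) ` Sigma generic_pairs shifts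
    \<union> (\<lambda>((a, c), b). (a + b - c, c, a)) ` Sigma torsion_pairs (\<lambda>(a, c). A - {a, c})"
  (is "_ \<subseteq> ?f ` _ \<union> ?g ` _ \<union> ?h ` _ \<union> ?h ` _")
proof
  fix p assume "p \<in> collisions"
  then obtain x c c' where p: "p = (x, c, c')" and cc: "c \<noteq> c'" and R: "(x, c) \<in> reps" "(x, c') \<in> reps"
    by (auto simp: collisions_def)
  obtain a b where ab: "(a, b, c) \<in> triples" "x = a + b - c" using R(1) by (auto simp: reps_def)
  obtain d e where de: "(d, e, c') \<in> triples" "x = d + e - c'" using R(2) by (auto simp: reps_def)
  have first: "\<exists>b'. (c', b', c) \<in> triples \<and> x = c' + b' - c" if "c' \<in> {a, b}"
    using that ab by (auto simp: triples_def add.commute)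
  have second: "\<exists>e'. (c, e', c') \<in> triples \<and> x = c + e' - c'" if "c \<in> {d, e}"
    using that de by (auto simp: triples_def add.commute)
  have f: "p = ?f ((c', b'), c)" if "x = c' + b' - c" for b' using that p by simp
  have g: "p = ?g ((c, e'), c')" if "x = c + e' - c'" for e' using that p by simp
  have h: "p = ?h ((c', c), b')" if "x = c' + b' - c" for b' using that p by simp
  consider "c' \<in> {a, b}" "c \<in> {d, e}" | "c' \<in> {a, b}" "c \<notin> {d, e}" | "c' \<notin> {a, b}" "c \<in> {d, e}"
    | "c' \<notin> {a, b}" "c \<notin> {d, e}" by blast
  then show "p \<in> ?f ` one_sided \<union> ?g ` one_sided \<union> ?h ` Sigma generic_pairs shifts
      \<union> ?h ` Sigma torsion_pairs (\<lambda>(a, c). A - {a, c})"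
  proof cases
    case 1
    then obtain b' e' where *: "(c', b', c) \<in> triples" "x = c' + b' - c"
      "(c, e', c') \<in> triples" "x = c + e' - c'"
      using first second by blast
    from collision_two_sided[OF *(1,3)] *(2,4)
    have "((c', c), b') \<in> Sigma generic_pairs shifts
        \<or> ((c', c), b') \<in> Sigma torsion_pairs (\<lambda>(a, c). A - {a, c})" by simp
    then show ?thesis using h[OF *(2)] by blast
  next
    case 2
    then obtain b' where *: "(c', b', c) \<in> triples" "x = c' + b' - c" using first by blast
    then have "((c', b'), c) \<in> one_sided" using collision_one_sided[of c' b' c d e] de 2 by simp
    then show ?thesis using f[OF *(2)] by blast
  next
    case 3
    then obtain e' where *: "(c, e', c') \<in> triples" "x = c + e' - c'" using second by blast
    then have "((c, e'), c') \<in> one_sided" using collision_one_sided[of c e' c' a b] ab 3 by simp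
    then show ?thesis using g[OF *(2)] by blast
  next
    case 4
    have "a + b + c' = x + c + c'" using ab by simp
    also have "\<dots> = d + e + c" using de by (simp add: algebra_simps)
    finally have "{a, b, c'} = {d, e, c}"
      by (rule triple_sum_unique) (use ab de 4 in \<open>auto simp: triples_def\<close>)
    then have "c \<in> {a, b, c'}" by blast
    then show ?thesis using ab cc by (auto simp: triples_def)
  qed
qed

lemma card_collisions:
  "card collisions \<le> 2 * card one_sided + (\<Sum>p\<in>generic_pairs. card (shifts p))
    + 2 * card realised * (card A - 2)"
proof -
  let ?f = "\<lambda>((a, b), c). (a + b - c, c, a)" and ?g = "\<lambda>((a, b), c). (a + b - c, a, c)"
    and ?h = "\<lambda>((a, c), b). (a + b - c, c, a :: 'a)"
  let ?T = "Sigma torsion_pairs (\<lambda>(a, c). A - {a, c})"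
  have "card collisions \<le> card (?f ` one_sided \<union> ?g ` one_sided \<union> ?h ` Sigma generic_pairs shifts \<union> ?h ` ?T)"
    by (intro card_mono collisions_cover) simp
  also have "\<dots> \<le> card (?f ` one_sided) + card (?g ` one_sided) + card (?h ` Sigma generic_pairs shifts) + card (?h ` ?T)"
    by (rule order_trans[OF card_Un_le], rule add_right_mono,
        rule order_trans[OF card_Un_le], rule add_right_mono, rule card_Un_le)
  also have "\<dots> \<le> card one_sided + card one_sided + card (Sigma generic_pairs shifts) + card ?T"
    by (intro add_mono card_image_le) simp_all
  also have "card (Sigma generic_pairs shifts) = (\<Sum>p\<in>generic_pairs. card (shifts p))"
    by (simp add: card_SigmaI)
  also have "card ?T = (\<Sum>p\<in>torsion_pairs. card A - 2)"
  proof -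
    have "card (case p of (a, c) \<Rightarrow> A - {a, c}) = card A - 2" if "p \<in> torsion_pairs" for p
      using that by (auto simp: torsion_pairs_def card_Diff_subset)
    then show ?thesis by (simp add: card_SigmaI)
  qed
  finally show ?thesis by (simp add: card_torsion_pairs)
qed

end

section \<open>The lower bound for the group order\<close>

text \<open>
  Here \<open>h1\<close>, \<open>h2\<close>, \<open>h3\<close> count the ordered pairs \<open>(a, c)\<close> for which several \<open>b\<close> are possible, split
  according to \<open>t = 2a - 2c\<close>: \<open>h2\<close> for order two, \<open>h3\<close> for order three, \<open>h1\<close> for the other
  steps of progressions.  The numbers of midpoints are \<open>n1\<close> and \<open>n3\<close>, and those of
  realised and unrealised elements of order two are \<open>d\<close> and \<open>z\<close>.

  If \<open>z \<ge> k - 2\<close>, the bound by the total number of pairs suffices, helped by the saving from one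
  midpoint when \<open>h3\<close> may be positive.  Otherwise \<open>h3\<close> is paid for by the saving
  \<open>k - 3\<close> of each coset midpoint.  For \<open>h1 + h2\<close> the total number of pairs suffices again unless
  \<open>2(n1 + z) \<le> k - 3\<close>.  In that case the condition on \<open>r\<close> gives \<open>d \<le> 2z + 4\<close>, so that the
  excess over the savings, at most \<open>z(d + n1)\<close>, stays below the allowance \<open>z(k - 2) + 2k\<close>.
\<close>

lemma excess_arithmetic:
  fixes k d z n1 n3 r h1 h2 h3 :: int
  assumes k: "5 \<le> k" and nn: "0 \<le> d" "0 \<le> z" "0 \<le> n1" "0 \<le> n3" "0 \<le> r" "0 \<le> h1" "0 \<le> h2" "0 \<le> h3"
    and total: "h2 + h1 + h3 \<le> k * (k - 1) - 2 * d"
    and h2: "h2 \<le> d * (2 * (1 + z))"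
    and h1: "h1 \<le> n1 * 2 * (z + k - 4)"
    and h3: "h3 \<le> n3 * z"
    and d: "d \<le> 1 + 2 * r + z" and r: "r * (r - 1) \<le> 2 * z"
  shows "h2 + h1 + 2 * h3 \<le> 2 * d + 4 * k + 2 * z * (k - 2) + 2 * (n1 + n3) * (k - 3)"
proof (cases "k - 2 \<le> z")
  case True
  have "(k - 2) * (k - 2) \<le> z * (k - 2)" using True k by (intro mult_right_mono) auto
  moreover have "(k - 2) * (k - 2) = k * (k - 1) - 3 * k + 4" by (simp add: algebra_simps)
  ultimately have zk: "k * (k - 1) - 3 * k + 4 \<le> z * (k - 2)" by simp
  have kk: "k * 4 \<le> k * (k - 1)" using k by (intro mult_left_mono) auto
  have z2: "2 * z * (k - 2) = 2 * (z * (k - 2))" by simp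
  show ?thesis
  proof (cases "n1 + n3 = 0")
    case True
    then have "n1 = 0" "n3 = 0" using nn by auto
    moreover from this have "h3 = 0" using h3 nn by simp
    moreover have "h2 + h1 \<le> 2 * d + 4 * k + 2 * (z * (k - 2))"
      using nn total zk kk k \<open>h3 = 0\<close> by linarith
    ultimately show ?thesis by (simp only: z2) simp
  next
    case False
    define V where "V = (n1 + n3) * (k - 3)"
    have "1 * (k - 3) \<le> (n1 + n3) * (k - 3)" using False nn k by (intro mult_right_mono) auto
    then have "k - 3 \<le> V" by (simp add: V_def)
    then have "h2 + h1 + 2 * h3 \<le> 2 * d + 4 * k + 2 * (z * (k - 2)) + 2 * V"
      using total zk nn k by linarith
    then have "h2 + h1 + 2 * h3 \<le> 2 * d + 4 * k + 2 * (z * (k - 2)) + 2 * ((n1 + n3) * (k - 3))"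
      unfolding V_def .
    then show ?thesis by (simp only: mult.assoc)
  qed
next
  case False
  have "n3 * z \<le> n3 * (k - 3)" using False nn by (intro mult_left_mono) auto
  then have h3': "2 * h3 \<le> 2 * n3 * (k - 3)" using h3 by simp
  have "h2 + h1 \<le> 2 * d + 4 * k + 2 * z * (k - 2) + 2 * n1 * (k - 3)"
  proof (cases "k * (k - 1) \<le> 4 * k + 2 * z * (k - 2) + 2 * n1 * (k - 3)")
    case True
    then show ?thesis using total nn by linarith
  next
    case False
    have small: "2 * (n1 + z) \<le> k - 3"
    proof (rule ccontr)
      assume "\<not> ?thesis"
      then have "(k - 2) * (k - 3) \<le> 2 * (n1 + z) * (k - 3)" using k by (intro mult_right_mono) auto
      also have "\<dots> = 2 * z * (k - 2) + 2 * n1 * (k - 3) - 2 * z" by (simp add: algebra_simps)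
      finally have "(k - 2) * (k - 3) \<le> 2 * z * (k - 2) + 2 * n1 * (k - 3)" using nn by simp
      moreover have "(k - 2) * (k - 3) = k * (k - 1) - 4 * k + 6" by (simp add: algebra_simps)
      ultimately show False using False by linarith
    qed
    \<comment> \<open>with \<open>r(r - 1) \<le> 2z\<close> this integer inequality gives \<open>2r \<le> z + 3\<close>\<close>
    have "0 \<le> (r - 2) * (r - 3)"
      by (cases "r \<le> 2") (simp_all add: mult_nonpos_nonpos)
    then have "2 * r \<le> z + 3" using r by (simp add: algebra_simps)
    then have d': "d \<le> 2 * z + 4" using d by simp
    have "z * (2 * (d + n1)) \<le> z * (2 * z + 5 + k)"
      using d' small nn by (intro mult_left_mono) auto
    moreover have "z * (2 * z + 9 - k) \<le> z * 6"
      using small nn by (intro mult_left_mono) auto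
    ultimately have "z * (2 * (d + n1)) \<le> 4 * k + 2 * z * (k - 2)"
      using small nn k by (simp add: algebra_simps)
    then show ?thesis using h1 h2 nn by (simp add: algebra_simps)
  qed
  then show ?thesis using h3' by (simp add: algebra_simps)
qed

context S3_set
begin

text \<open>
  Collisions are counted as ordered pairs, which puts a factor 2 on every term.
\<close>

lemma group_order_bound:
  defines "k \<equiv> int (card A)"
  shows "k * (k - 1) * (k - 2) \<le> 2 * int (card (UNIV :: 'a set)) + 7 * (k * (k - 1)) + 4 * k
    + 2 * int (card (two_torsion :: 'a set)) * (k - 2)"
proof -
  obtain r where r: "card realised \<le> 1 + 2 * r + card unrealised" "r * (r - 1) \<le> 2 * card unrealised"
    by (rule realised_bound)
  define d where "d = int (card realised)"
  define z where "z = int (card unrealised)"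
  define n1 where "n1 = int (card midpoints)"
  define n3 where "n3 = int (card coset_midpoints)"
  define h2 where "h2 = int (card (doubled_over realised))"
  define h1 where "h1 = int (card (doubled_over steps))"
  define h3 where "h3 = int (card (doubled_over coset_steps))"
  define G where "G = int (card (UNIV :: 'a set))"
  have k5: "5 \<le> k" using card_ge_5 by (simp add: k_def)
  have sub: "int (card A - m) = k - int m" if "m \<le> 4" for m
    using that card_ge_5 by (simp add: k_def of_nat_diff)
  have "int (card A * (card A - 1)) = k * (k - 1)" using sub[of 1] by (simp add: k_def)
  note kk = this
  have gp: "int (card generic_pairs) + 2 * d = k * (k - 1)"
    using card_generic_pairs kk by (simp add: d_def flip: of_nat_add of_nat_mult)
  have rr: "int r * (int r - 1) \<le> 2 * z"
  proof (cases "r = 0")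
    case False
    then have "int r * (int r - 1) = int (r * (r - 1))" by (simp add: of_nat_diff)
    also have "\<dots> \<le> int (2 * card unrealised)" using r(2) by (rule of_nat_mono)
    finally show ?thesis by (simp add: z_def)
  qed (simp add: z_def)
  have X: "h2 + h1 + 2 * h3 \<le> 2 * d + 4 * k + 2 * z * (k - 2) + 2 * (n1 + n3) * (k - 3)"
  proof (rule excess_arithmetic[OF k5])
    show "h2 + h1 + h3 \<le> k * (k - 1) - 2 * d"
      using card_doubled_over_disjoint_sum gp by (simp add: h1_def h2_def h3_def)
    show "h2 \<le> d * (2 * (1 + z))"
      using of_nat_mono[OF card_doubled_over_realised, where 'a = int]
      by (simp add: h2_def d_def z_def algebra_simps)
    have "h1 \<le> int (card midpoints * 2 * (card unrealised + card A - 4))"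
      using card_doubled_over_steps unfolding h1_def by (rule of_nat_mono)
    also have "\<dots> = n1 * 2 * (z + k - 4)"
      using card_ge_5 by (simp add: n1_def z_def k_def of_nat_diff)
    finally show "h1 \<le> n1 * 2 * (z + k - 4)" .
    show "h3 \<le> n3 * z"
      using of_nat_mono[OF card_doubled_over_coset_steps, where 'a = int] by (simp add: h3_def n3_def z_def)
    show "d \<le> 1 + 2 * int r + z" using r(1) by (simp add: d_def z_def)
  qed (use rr in \<open>simp_all add: d_def z_def n1_def n3_def h1_def h2_def h3_def\<close>)
  have M: "int (\<Sum>p\<in>generic_pairs. card (shifts p)) \<le> k * (k - 1) - 2 * d + h2 + h1 + 2 * h3"
    using of_nat_mono[OF sum_card_shifts, where 'a = int] gp
    by (simp add: h1_def h2_def h3_def del: of_nat_sum)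
  have N: "int (card (midpoints \<union> coset_midpoints)) = n1 + n3"
    using midpoints_disjoint by (simp add: n1_def n3_def card_Un_disjoint)
  have "int (card one_sided + card (midpoints \<union> coset_midpoints) * (card A - 3))
      \<le> int (3 * (card A * (card A - 1)))"
    using card_one_sided by (rule of_nat_mono)
  then have L: "int (card one_sided) + (n1 + n3) * (k - 3) \<le> 3 * (k * (k - 1))"
    using N sub[of 3] kk by simp
  have "card triples \<le> 2 * card (fst ` reps) + card collisions"
    using card_triples_le_reps two_card_le_image_plus_collisions[of reps] by (simp add: collisions_def)
  also have "\<dots> \<le> 2 * card (UNIV :: 'a set) + (2 * card one_sided + (\<Sum>p\<in>generic_pairs. card (shifts p))
      + 2 * card realised * (card A - 2))"
    by (intro add_mono mult_left_mono card_mono card_collisions) simp_all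
  finally have "int (card triples) \<le> int (2 * card (UNIV :: 'a set) + (2 * card one_sided
      + (\<Sum>p\<in>generic_pairs. card (shifts p)) + 2 * card realised * (card A - 2)))"
    by (rule of_nat_mono)
  then have main: "k * (k - 1) * (k - 2) \<le> 2 * G + 2 * int (card one_sided)
      + int (\<Sum>p\<in>generic_pairs. card (shifts p)) + 2 * d * (k - 2)"
    using sub[of 1] sub[of 2] by (simp add: card_triples G_def d_def k_def del: of_nat_sum)
  have "card (two_torsion :: 'a set) = card realised + card unrealised"
    unfolding realised_def by (subst card_Diff_subset) (auto simp: unrealised_def intro!: le_add_diff_inverse2[symmetric] card_mono)
  then have "int (card (two_torsion :: 'a set)) = d + z" by (simp add: d_def z_def)
  then have "2 * int (card (two_torsion :: 'a set)) * (k - 2) = 2 * d * (k - 2) + 2 * z * (k - 2)"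
    by (simp add: algebra_simps)
  moreover have "2 * (n1 + n3) * (k - 3) = 2 * ((n1 + n3) * (k - 3))" by simp
  ultimately show ?thesis using main M L X unfolding G_def by linarith
qed

end

theorem theorem1p2:
  fixes k :: nat and A :: "'a::{ab_group_add,finite} set"
  assumes "k \<ge> 5"
    and "card A = k"
    and "S_set 3 A"
  shows "real (card (UNIV :: 'a set)) \<ge>
           real k * (real k - 1) * (real k - 2) / 2
           - 7 * real k * (real k - 1) / 2
           - 2 * real k
           - real (card (two_torsion :: 'a set)) * (real k - 2)"
proof -
  interpret S3_set A by unfold_locales (use assms in auto)
  have "real_of_int (int k * (int k - 1) * (int k - 2))
      \<le> real_of_int (2 * int (card (UNIV :: 'a set)) + 7 * (int k * (int k - 1)) + 4 * int k
          + 2 * int (card (two_torsion :: 'a set)) * (int k - 2))"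
    using group_order_bound unfolding assms(2) by (rule of_int_le_iff[THEN iffD2])
  then show ?thesis by (simp add: field_simps)
qed

end
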